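(* Let $m\ge 1$ be an integer, let $s\in\{3,4\}$, and put $n=sm+s-2$. Then $$e(n,s)=\binom{n-1}{m-1}+\sum_{m+1\le t\le n}\binom{n}{t}.$$
   Context: For a positive integer $n$, $[n]=\{1,2,\ldots,n\}$ and $2^{[n]}$ denotes its power set. A family is a subset $\mathcal F\subset 2^{[n]}$. For a family $\mathcal F$, $\nu(\mathcal F)$ denotes the maximum number of pairwise disjoint members of $\mathcal F$ (the matching number, also called the independence number, of $\mathcal F$). For integers $n$ and $s$, $e(n,s)$ denotes the size of the largest family $\mathcal F\subset 2^{[n]}$ with $\nu(\mathcal F)<s$, that is, the maximum of $|\mathcal F|$ over all families $\mathcal F\subset 2^{[n]}$ containing no $s$ pairwise disjoint members. *)

theory Defs
  imports Main "HOL-Library.Disjoint_Sets"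
begin

text \<open>The members of a matching are distinct, so if the empty set belongs to the family, it can
  be used at most once. The value is meaningful for finite families only.\<close>

definition matching_number :: "'a set set \<Rightarrow> nat" where
  "matching_number F = Max {card M | M. M \<subseteq> F \<and> disjoint M}"

text \<open>For \<open>s \<ge> 1\<close> the maximum ranges over a nonempty finite set, since the empty family
  has matching number 0.\<close>

definition max_family_size :: "nat \<Rightarrow> nat \<Rightarrow> nat" where
  "max_family_size n s = Max {card F | F. F \<subseteq> Pow {1..n} \<and> matching_number F < s}"

end

theory Submission
  imports Defs "HOL-Combinatorics.Permutations" Complex_Main
begin

text \<open>
Put \<open>n + 2 = s (m + 1)\<close>. The value is attained by the sets of weight at least \<open>m + 1\<close>, where the point 1
has weight 2 and all other points weight 1: the ground set has weight \<open>s (m + 1) - 1\<close>, so \<open>s\<close> disjoint sets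
do not fit. This family contains all sets with more than \<open>m\<close> elements and, on level \<open>m\<close>, the star of 1.

For the upper bound the family may be taken upward closed, once the empty set has been exchanged for another set.
Let \<open>d k\<close> be the fraction of the \<open>k\<close>-sets that belong to it. What the family has
on the levels up to \<open>m\<close>, beyond the size of a star on level \<open>m\<close>, must be compensated by the deficits
\<open>1 - d k\<close> above. Inequalities between the \<open>d k\<close> come from configurations of disjoint sets: in a partition
of the ground set into \<open>s\<close> parts some part is missing. Such a statement about fixed index sets is averaged over
all relabellings of the points.

Level \<open>m\<close>. Take \<open>s\<close> disjoint \<open>m\<close>-sets and the \<open>s - 2\<close> remaining points. If several of the
\<open>m\<close>-sets are members, then some of the others, enlarged by remaining points, are missing.
This gives \<open>d m \<le> 1/s\<close> plus a multiple of \<open>1 - d (m + 1)\<close>, while a star has only \<open>d m = m/n\<close>. The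
difference \<open>1/s - m/n\<close> is gained by placing the configuration on a circle of \<open>n\<close> points
and summing over the \<open>n\<close> rotations, because \<open>n\<close> is not divisible by \<open>s\<close>. For \<open>s = 4\<close> a parity argument
(\<open>cyclic_four_windows\<close>) finds the gain for free. For \<open>s = 3\<close> integrality (\<open>cyclic_three_windows\<close>)
finds it at the price of the factor \<open>3/2\<close> in front of \<open>1 - d (m + 1)\<close>.

Levels below \<open>m\<close>. A partition into one set of size \<open>m - 1\<close> and \<open>s - 1\<close> sets of size \<open>m + 1\<close> bounds
\<open>d (m - 1)\<close> by deficits of level \<open>m + 1\<close>, and moving one point bounds \<open>d (m - 2)\<close> as well, at the cost of level \<open>m + 2\<close>.
All lower levels are small in comparison. For \<open>s = 4\<close> this just exhausts the deficit left over by level \<open>m\<close>. For \<open>s = 3\<close>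
less is left, and the estimate is improved: in the complement of a missing
\<open>(m + 1)\<close>-set, which has \<open>2m\<close> points, two members of size \<open>m - 1\<close> can be disjoint only if further sets are missing, so
they are restricted by the Erdos-Ko-Rado bound (\<open>circle_complement\<close>). The saving is exactly what is needed.
\<close>

section \<open>Upward closed families without pairwise disjoint members\<close>

text \<open>The forbidden matchings are indexed by \<open>{..<s}\<close> rather than given as sets of members, so
that a repeated empty set counts. Hence the empty set is never a member, and the \<open>s\<close>
disjoint members of a configuration need not be shown distinct.\<close>

definition upset_free :: "nat \<Rightarrow> nat \<Rightarrow> nat set set \<Rightarrow> bool" where
  "upset_free s n F \<longleftrightarrow> F \<subseteq> Pow {..<n} \<and> (\<forall>A\<in>F. \<forall>B\<subseteq>{..<n}. A \<subseteq> B \<longrightarrow> B \<in> F) \<and>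
     \<not> (\<exists>A. (\<forall>i<s. A i \<in> F) \<and> disjoint_family_on A {..<s})"

definition relabel :: "nat \<Rightarrow> (nat \<Rightarrow> nat) \<Rightarrow> nat set set \<Rightarrow> nat set set" where
  "relabel n \<pi> F = {S. S \<subseteq> {..<n} \<and> \<pi> ` S \<in> F}"

lemma upset_free_upD: "upset_free s n F \<Longrightarrow> A \<in> F \<Longrightarrow> A \<subseteq> B \<Longrightarrow> B \<subseteq> {..<n} \<Longrightarrow> B \<in> F"
  by (auto simp: upset_free_def)

lemma upset_free_three:
  assumes "upset_free 3 n F" "A \<in> F" "B \<in> F" "C \<in> F" "A \<inter> B = {}" "A \<inter> C = {}" "B \<inter> C = {}"
  shows False
proof -
  define f where "f = (\<lambda>i::nat. if i = 0 then A else if i = 1 then B else C)"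
  have "(\<forall>i<3. f i \<in> F) \<and> disjoint_family_on f {..<3}"
    using assms by (auto simp: f_def disjoint_family_on_def)
  with assms(1) show False by (auto simp: upset_free_def)
qed

lemma upset_free_four:
  assumes "upset_free 4 n F" "A \<in> F" "B \<in> F" "C \<in> F" "D \<in> F" "A \<inter> B = {}" "A \<inter> C = {}" "A \<inter> D = {}"
    "B \<inter> C = {}" "B \<inter> D = {}" "C \<inter> D = {}"
  shows False
proof -
  define f where "f = (\<lambda>i::nat. if i = 0 then A else if i = 1 then B else if i = 2 then C else D)"
  have "(\<forall>i<4. f i \<in> F) \<and> disjoint_family_on f {..<4}"
    using assms by (auto simp: f_def disjoint_family_on_def)
  with assms(1) show False by (auto simp: upset_free_def)
qed

lemma upset_free_relabel:
  assumes "upset_free s n F" "\<pi> permutes {..<n}"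
  shows "upset_free s n (relabel n \<pi> F)"
  unfolding upset_free_def
proof (intro conjI ballI allI impI notI)
  show "relabel n \<pi> F \<subseteq> Pow {..<n}" by (auto simp: relabel_def)
next
  fix A B assume "A \<in> relabel n \<pi> F" "B \<subseteq> {..<n}" "A \<subseteq> B"
  moreover have "\<pi> ` B \<subseteq> {..<n}"
    using \<open>B \<subseteq> {..<n}\<close> permutes_image[OF assms(2)] by blast
  ultimately show "B \<in> relabel n \<pi> F"
    using upset_free_upD[OF assms(1), of "\<pi> ` A" "\<pi> ` B"] by (auto simp: relabel_def)
next
  assume "\<exists>A. (\<forall>i<s. A i \<in> relabel n \<pi> F) \<and> disjoint_family_on A {..<s}"
  then obtain A where A: "\<forall>i<s. A i \<in> relabel n \<pi> F" "disjoint_family_on A {..<s}" by blast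
  have "inj \<pi>" using assms(2) by (rule permutes_inj)
  then have "disjoint_family_on (\<lambda>i. \<pi> ` A i) {..<s}"
    using A(2) unfolding disjoint_family_on_def by (metis image_Int image_empty)
  moreover have "\<forall>i<s. \<pi> ` A i \<in> F" using A(1) by (auto simp: relabel_def)
  ultimately show False using assms(1) unfolding upset_free_def
    by (auto dest: spec[of _ "\<lambda>i. \<pi> ` A i"])
qed

section \<open>Averages over relabellings\<close>

text \<open>An inequality between the indicators of finitely many fixed index sets that holds in every family of
this kind holds in every relabelling of a given family. Averaging over all relabellings turns
each indicator into a density that depends only on the size of the index set.\<close>

definition mean :: "nat \<Rightarrow> nat set set \<Rightarrow> (nat set set \<Rightarrow> real) \<Rightarrow> real" where
  "mean n F \<Phi> = (\<Sum>\<pi> | \<pi> permutes {..<n}. \<Phi> (relabel n \<pi> F)) / fact n"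

lemma mean_mono:
  assumes "upset_free s n F" "\<And>G. upset_free s n G \<Longrightarrow> \<Phi> G \<le> \<Psi> G"
  shows "mean n F \<Phi> \<le> mean n F \<Psi>"
  unfolding mean_def using assms upset_free_relabel[OF assms(1)]
  by (intro divide_right_mono sum_mono) auto

lemma mean_const: "mean n F (\<lambda>_. c) = c"
  by (simp add: mean_def card_permutations[of "{..<n}" n])

lemma mean_add: "mean n F (\<lambda>G. \<Phi> G + \<Psi> G) = mean n F \<Phi> + mean n F \<Psi>"
  by (simp add: mean_def sum.distrib add_divide_distrib)

lemma mean_diff: "mean n F (\<lambda>G. \<Phi> G - \<Psi> G) = mean n F \<Phi> - mean n F \<Psi>"
  by (simp add: mean_def sum_subtractf diff_divide_distrib)

lemma mean_cmult: "mean n F (\<lambda>G. c * \<Phi> G) = c * mean n F \<Phi>"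
  by (simp add: mean_def sum_distrib_left)

lemma mean_sum: "mean n F (\<lambda>G. \<Sum>i\<in>I. \<Phi> i G) = (\<Sum>i\<in>I. mean n F (\<Phi> i))"
  unfolding mean_def by (subst sum.swap) (simp add: sum_divide_distrib)

lemma mean_relabel:
  assumes "\<sigma> permutes {..<n}"
  shows "mean n F (\<lambda>G. \<Phi> (relabel n \<sigma> G)) = mean n F \<Phi>"
proof -
  have "relabel n \<sigma> (relabel n \<pi> F) = relabel n (\<pi> \<circ> \<sigma>) F" for \<pi>
  proof -
    have "\<sigma> ` S \<subseteq> {..<n}" if "S \<subseteq> {..<n}" for S
      using that permutes_image[OF assms] by blast
    then show ?thesis by (auto simp: relabel_def image_comp)
  qed
  then show ?thesis
    unfolding mean_def
    using sum_permutations_compose_right[OF assms, of "\<lambda>\<pi>. \<Phi> (relabel n \<pi> F)"] by simp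
qed

lemma permutes_pair_exists:
  fixes n :: nat
  assumes "A \<subseteq> {..<n}" "A' \<subseteq> {..<n}" "card A = card A'"
    and "B \<subseteq> {..<n}" "B' \<subseteq> {..<n}" "card B = card B'" "A \<inter> B = {}" "A' \<inter> B' = {}"
  shows "\<exists>\<sigma>. \<sigma> permutes {..<n} \<and> \<sigma> ` A = A' \<and> \<sigma> ` B = B'"
proof -
  note fin = assms(1,2,4,5)[THEN finite_subset[OF _ finite_lessThan]]
  have "card ({..<n} - (A \<union> B)) = card ({..<n} - (A' \<union> B'))"
    using assms fin by (simp add: card_Diff_subset card_Un_disjoint)
  then obtain h where h: "bij_betw h ({..<n} - (A \<union> B)) ({..<n} - (A' \<union> B'))"
    using finite_same_card_bij by blast
  obtain f where f: "bij_betw f A A'" using fin assms(3) finite_same_card_bij by blast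
  obtain g where g: "bij_betw g B B'" using fin assms(6) finite_same_card_bij by blast
  define \<sigma> where "\<sigma> = (\<lambda>x. if x \<in> A then f x else if x \<in> B then g x
      else if x < n then h x else x)"
  have eA: "bij_betw \<sigma> A A'"
    using f by (subst bij_betw_cong[of _ _ f]) (auto simp: \<sigma>_def)
  have eB: "bij_betw \<sigma> B B'"
    using g assms(7) by (subst bij_betw_cong[of _ _ g]) (auto simp: \<sigma>_def)
  have eC: "bij_betw \<sigma> ({..<n} - (A \<union> B)) ({..<n} - (A' \<union> B'))"
    using h by (subst bij_betw_cong[of _ _ h]) (auto simp: \<sigma>_def)
  have "bij_betw \<sigma> ((A \<union> B) \<union> ({..<n} - (A \<union> B))) ((A' \<union> B') \<union> ({..<n} - (A' \<union> B')))"
    using assms(8) by (intro bij_betw_combine eA eB eC) auto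
  then have "bij_betw \<sigma> {..<n} {..<n}"
    using assms by (simp add: Un_absorb1 Un_Diff_cancel)
  then have "\<sigma> permutes {..<n}"
    by (rule bij_imp_permutes) (use assms in \<open>auto simp: \<sigma>_def\<close>)
  with eA eB show ?thesis by (auto simp: bij_betw_def)
qed

text \<open>A permutation taking one disjoint pair to another reindexes the average. The
connective \<open>\<phi>\<close> allows joint events such as \<open>A \<in> G \<and> B \<notin> G\<close>, which densities alone do not
describe.\<close>

lemma mean_pair_cong:
  assumes "A \<subseteq> {..<n}" "A' \<subseteq> {..<n}" "card A = card A'"
    and "B \<subseteq> {..<n}" "B' \<subseteq> {..<n}" "card B = card B'" "A \<inter> B = {}" "A' \<inter> B' = {}"
  shows "mean n F (\<lambda>G. \<phi> (A \<in> G) (B \<in> G)) = mean n F (\<lambda>G. \<phi> (A' \<in> G) (B' \<in> G))"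
proof -
  obtain \<sigma> where s: "\<sigma> permutes {..<n}" "\<sigma> ` A = A'" "\<sigma> ` B = B'"
    using permutes_pair_exists[OF assms] by blast
  show ?thesis
    using mean_relabel[OF s(1), of F "\<lambda>G. \<phi> (A \<in> G) (B \<in> G)"] s assms by (simp add: relabel_def)
qed

definition level :: "nat set set \<Rightarrow> nat \<Rightarrow> nat set set" where
  "level F k = {A \<in> F. card A = k}"

definition density :: "nat \<Rightarrow> nat set set \<Rightarrow> nat \<Rightarrow> real" where
  "density n F k = card (level F k) / (n choose k)"

lemma card_level_relabel:
  assumes "F \<subseteq> Pow {..<n}" "\<pi> permutes {..<n}"
  shows "card (level (relabel n \<pi> F) k) = card (level F k)"
proof (rule bij_betw_same_card)
  have inj: "inj \<pi>" using assms(2) by (rule permutes_inj)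
  show "bij_betw ((`) \<pi>) (level (relabel n \<pi> F) k) (level F k)"
    unfolding bij_betw_def
  proof
    show "inj_on ((`) \<pi>) (level (relabel n \<pi> F) k)"
      using inj by (auto simp: inj_on_def inj_image_eq_iff)
    show "(`) \<pi> ` level (relabel n \<pi> F) k = level F k"
    proof
      show "(`) \<pi> ` level (relabel n \<pi> F) k \<subseteq> level F k"
        using inj by (auto simp: level_def relabel_def card_image inj_on_subset)
      show "level F k \<subseteq> (`) \<pi> ` level (relabel n \<pi> F) k"
      proof
        fix A assume A: "A \<in> level F k"
        then have sub: "A \<subseteq> {..<n}" using assms by (auto simp: level_def)
        then obtain S where S: "S \<subseteq> {..<n}" "A = \<pi> ` S"
          using permutes_image[OF assms(2)] by (metis subset_imageE)
        then have "S \<in> level (relabel n \<pi> F) k"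
          using A inj by (auto simp: level_def relabel_def card_image inj_on_subset)
        with S show "A \<in> (`) \<pi> ` level (relabel n \<pi> F) k" by blast
      qed
    qed
  qed
qed

text \<open>All index sets of size \<open>k\<close> have the same average by symmetry, and together they count the \<open>k\<close>-sets
of each relabelled family, of which there are as many as in \<open>F\<close>.\<close>

lemma mean_mem:
  assumes "F \<subseteq> Pow {..<n}" "S \<subseteq> {..<n}"
  shows "mean n F (\<lambda>G. of_bool (S \<in> G)) = density n F (card S)"
proof -
  define k where "k = card S"
  define K where "K = {T. T \<subseteq> {..<n} \<and> card T = k}"
  have finK: "finite K" unfolding K_def by (rule finite_subset[of _ "Pow {..<n}"]) auto
  have cK: "card K = n choose k" unfolding K_def using n_subsets[of "{..<n}" k] by simp
  have kn: "k \<le> n" unfolding k_def using card_mono[OF _ assms(2)] by simp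
  have "(\<Sum>T\<in>K. mean n F (\<lambda>G. of_bool (T \<in> G))) = (\<Sum>T\<in>K. mean n F (\<lambda>G. of_bool (S \<in> G)))"
  proof (rule sum.cong[OF refl])
    fix T assume "T \<in> K"
    then show "mean n F (\<lambda>G. of_bool (T \<in> G)) = mean n F (\<lambda>G. of_bool (S \<in> G))"
      using assms(2) by (intro mean_pair_cong[where B="{}" and B'="{}" and \<phi>="\<lambda>a b. of_bool a"])
        (auto simp: K_def k_def)
  qed
  moreover have "(\<Sum>T\<in>K. mean n F (\<lambda>G. of_bool (T \<in> G))) = card (level F k)"
  proof -
    have "(\<Sum>T\<in>K. of_bool (T \<in> relabel n \<pi> F)) = real (card (level F k))" if "\<pi> permutes {..<n}" for \<pi>
    proof -
      have "(\<Sum>T\<in>K. of_bool (T \<in> relabel n \<pi> F)) = real (card {T \<in> K. T \<in> relabel n \<pi> F})"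
        using finK by (simp add: sum.If_cases of_bool_def Int_def)
      also have "{T \<in> K. T \<in> relabel n \<pi> F} = level (relabel n \<pi> F) k"
        by (auto simp: K_def level_def relabel_def)
      finally show ?thesis using card_level_relabel[OF assms(1) that] by simp
    qed
    then have "mean n F (\<lambda>G. \<Sum>T\<in>K. of_bool (T \<in> G)) = real (card (level F k))"
      unfolding mean_def by (simp add: card_permutations[of "{..<n}" n])
    then show ?thesis by (simp add: mean_sum)
  qed
  ultimately have "real (n choose k) * mean n F (\<lambda>G. of_bool (S \<in> G)) = card (level F k)"
    by (simp add: cK)
  then show ?thesis
    using kn by (simp add: density_def k_def[symmetric] field_simps)
qed

lemma mean_notmem:
  assumes "F \<subseteq> Pow {..<n}" "S \<subseteq> {..<n}"
  shows "mean n F (\<lambda>G. of_bool (S \<notin> G)) = 1 - density n F (card S)"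
  using mean_mem[OF assms] mean_diff[of n F "\<lambda>_. 1" "\<lambda>G. of_bool (S \<in> G)"]
  by (simp add: of_bool_not_iff mean_const)

lemma density_mono:
  assumes "upset_free s n F" "i \<le> j" "j \<le> n"
  shows "density n F i \<le> density n F j"
proof -
  have F: "F \<subseteq> Pow {..<n}" using assms(1) by (simp add: upset_free_def)
  have sub: "{..<i} \<subseteq> {..<n}" "{..<j} \<subseteq> {..<n}" using assms by auto
  have "mean n F (\<lambda>G. of_bool ({..<i} \<in> G)) \<le> mean n F (\<lambda>G. of_bool ({..<j} \<in> G))"
  proof (rule mean_mono[OF assms(1)])
    fix G assume "upset_free s n G"
    then show "(of_bool ({..<i} \<in> G) :: real) \<le> of_bool ({..<j} \<in> G)"
      using assms sub by (auto dest: upset_free_upD[of s n G "{..<i}" "{..<j}"])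
  qed
  then show ?thesis using mean_mem[OF F] sub by simp
qed

lemma density_le_1:
  assumes "F \<subseteq> Pow {..<n}" "k \<le> n"
  shows "density n F k \<le> 1"
proof -
  have "card (level F k) \<le> n choose k"
    using card_mono[of "{A. A \<subseteq> {..<n} \<and> card A = k}" "level F k"] n_subsets[of "{..<n}" k] assms
    by (auto simp: level_def intro: finite_subset[of _ "Pow {..<n}"])
  then show ?thesis using assms by (simp add: density_def)
qed

section \<open>Arcs on a circle\<close>

definition rot :: "nat \<Rightarrow> nat \<Rightarrow> nat set \<Rightarrow> nat set" where
  "rot N p X = (\<lambda>i. (p + i) mod N) ` X"

lemma inj_on_rot: "inj_on (\<lambda>i. (p + i) mod N) {..<N::nat}"
proof (rule inj_onI)
  fix x y :: nat assume xy: "x \<in> {..<N}" "y \<in> {..<N}" "(p + x) mod N = (p + y) mod N"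
  show "x = y"
  proof (cases "x \<le> y")
    case True
    then have "N dvd y - x"
      using xy mod_eq_dvd_iff_nat[of "p + x" "p + y" N] by simp
    then show ?thesis using True xy by (auto dest: dvd_imp_le)
  next
    case False
    then have "N dvd x - y"
      using xy mod_eq_dvd_iff_nat[of "p + y" "p + x" N] by simp
    then show ?thesis using False xy by (auto dest: dvd_imp_le)
  qed
qed

lemma rot_subset: "N > 0 \<Longrightarrow> rot N p X \<subseteq> {..<N}"
  by (auto simp: rot_def)

lemma card_rot: "X \<subseteq> {..<N} \<Longrightarrow> card (rot N p X) = card X"
  unfolding rot_def by (rule card_image) (rule inj_on_subset[OF inj_on_rot])

lemma rot_disjoint: "X \<subseteq> {..<N} \<Longrightarrow> Y \<subseteq> {..<N} \<Longrightarrow> X \<inter> Y = {} \<Longrightarrow> rot N p X \<inter> rot N p Y = {}"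
  using inj_on_image_Int[OF inj_on_rot, of X N Y p] by (simp add: rot_def)

lemma rot_add: "rot N (p + c) {a..<b} = rot N p {c + a..<c + b}"
proof -
  have "{c + a..<c + b} = (\<lambda>i. c + i) ` {a..<b}" by (simp add: add.commute)
  then show ?thesis by (simp add: rot_def image_image add.assoc del: image_add_atLeastLessThan)
qed

lemma rot_period: "rot N (p + N) X = rot N p X"
proof -
  have "(p + N + i) mod N = (p + i) mod N" for i
    by (metis add.assoc add.commute mod_add_self2)
  then show ?thesis by (simp add: rot_def)
qed

lemma sum_cyclic_shift:
  fixes a :: "nat \<Rightarrow> 'a::ab_group_add"
  assumes "\<And>p. a (p + N) = a p"
  shows "(\<Sum>p<N. a (p + c)) = (\<Sum>p<N. a p)"
proof (induction c)
  case (Suc c)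
  have "(\<Sum>p<N. a (p + Suc c)) = (\<Sum>p<N. a (Suc p + c))" by simp
  also have "\<dots> = (\<Sum>p<Suc N. a (p + c)) - a c"
    by (subst sum.lessThan_Suc_shift) simp
  also have "\<dots> = (\<Sum>p<N. a (p + c)) - a c + a (N + c)" by simp
  also have "a (N + c) = a c" using assms[of c] by (simp add: add.commute)
  finally show ?case using Suc by simp
qed simp

section \<open>Cyclic zero-one sequences\<close>

text \<open>Let \<open>k\<close>, \<open>P\<close> and \<open>Q\<close> be the three sums in the conclusion. A window at \<open>p\<close>, \<open>p + m\<close>, \<open>p + 2m\<close>
satisfies \<open>x + y + z \<le> 1 + xy + yz + xz\<close>, and summing over all windows gives
\<open>3k \<le> 3m + 1 + 2P + Q\<close>. Since \<open>3m + 1\<close> is not divisible by 3, integrality absorbs the extra 1: if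
\<open>2P + Q \<le> 1\<close> then \<open>k \<le> m\<close>, and otherwise \<open>1 \<le> (2P + Q) / 2\<close>.\<close>

lemma cyclic_three_windows:
  fixes a :: "nat \<Rightarrow> int"
  assumes a01: "\<And>p. a p \<in> {0, 1}" and per: "\<And>p. a (p + (3 * m + 1)) = a p"
  defines "N \<equiv> 3 * m + 1"
  shows "2 * (\<Sum>p<N. a p) \<le> 2 * int m + 2 * (\<Sum>p<N. a p * a (p + m)) + (\<Sum>p<N. a p * a (p + 2 * m))"
proof -
  let ?k = "\<Sum>p<N. a p" and ?P = "\<Sum>p<N. a p * a (p + m)" and ?Q = "\<Sum>p<N. a p * a (p + 2 * m)"
  have sh: "(\<Sum>p<N. a (p + c)) = ?k" for c
    using sum_cyclic_shift[of a N c] per by (simp add: N_def)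
  have shP: "(\<Sum>p<N. a (p + m) * a (p + 2 * m)) = ?P"
  proof -
    have "a (p + N) * a (p + N + m) = a p * a (p + m)" for p
      using per[of p] per[of "p + m"] by (simp add: N_def ac_simps)
    from sum_cyclic_shift[of "\<lambda>p. a p * a (p + m)" N m, OF this] show ?thesis
      by (simp add: add.assoc mult_2)
  qed
  have "(\<Sum>p<N. a p + a (p + m) + a (p + 2 * m)) \<le>
      (\<Sum>p<N. 1 + a p * a (p + m) + a (p + m) * a (p + 2 * m) + a p * a (p + 2 * m))"
  proof (rule sum_mono)
    fix p
    show "a p + a (p + m) + a (p + 2 * m) \<le>
      1 + a p * a (p + m) + a (p + m) * a (p + 2 * m) + a p * a (p + 2 * m)"
      using a01[of p] a01[of "p + m"] a01[of "p + 2 * m"] by auto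
  qed
  then have "3 * ?k \<le> int N + 2 * ?P + ?Q"
    by (simp add: sum.distrib sh shP)
  moreover have "?P \<ge> 0" "?Q \<ge> 0"
    using a01 by (auto intro!: sum_nonneg mult_nonneg_nonneg) (metis insertE order_refl singletonD zero_le_one)+
  \<comment> \<open>integrality is used here: over the rationals the bound would be off by 2/3\<close>
  ultimately show ?thesis unfolding N_def by presburger
qed

text \<open>The number of even windows is even, because the windows add up to \<open>4\<close> times the number of ones and there is an
even number of windows. It remains to exclude that all windows are odd. Consecutive windows along the
step \<open>m\<close> differ by \<open>a p - a (p + 2)\<close> up to a shift, as \<open>4m + 2\<close> is a full turn. This difference is
then even, so \<open>a\<close> has period 2, which makes every window even.\<close>

lemma cyclic_four_windows:
  fixes a :: "nat \<Rightarrow> int"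
  assumes a01: "\<And>p. a p \<in> {0, 1}" and per: "\<And>p. a (p + (4 * m + 2)) = a p"
  defines "N \<equiv> 4 * m + 2"
  defines "w \<equiv> \<lambda>p. a p + a (p + m) + a (p + 2 * m) + a (p + 3 * m)"
  shows "(\<Sum>p<N. of_bool (even (w p))) \<ge> (2::int)"
proof -
  let ?e = "\<Sum>p<N. of_bool (even (w p)) :: int"
  have sh: "(\<Sum>p<N. a (p + c)) = (\<Sum>p<N. a p)" for c
    using sum_cyclic_shift[of a N c] per by (simp add: N_def)
  have tot: "(\<Sum>p<N. w p) = 4 * (\<Sum>p<N. a p)"
    by (simp add: w_def sum.distrib sh)
  have "even (\<Sum>p<N. w p - (1 - of_bool (even (w p))))"
    by (rule dvd_sum) (auto)
  moreover have "(\<Sum>p<N. w p - (1 - of_bool (even (w p)))) = 4 * (\<Sum>p<N. a p) - int N + ?e"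
    by (simp add: sum_subtractf tot)
  moreover have "even (int N)" by (simp add: N_def)
  ultimately have ev: "even ?e" by presburger
  have "?e \<noteq> 0"
  proof
    assume "?e = 0"
    then have "\<forall>p<N. odd (w p)" by (subst (asm) sum_nonneg_eq_0_iff) auto
    have wper: "w (p + N) = w p" for p
      using per[of p] per[of "p + m"] per[of "p + 2 * m"] per[of "p + 3 * m"]
      by (simp add: w_def N_def ac_simps)
    have odd: "odd (w p)" for p
    proof (induction p rule: less_induct)
      case (less p)
      show ?case
      proof (cases "p < N")
        case False
        then have "w p = w (p - N)" using wper[of "p - N"] by simp
        then show ?thesis using less[of "p - N"] False by (simp add: N_def)
      qed (use \<open>\<forall>p<N. odd (w p)\<close> in auto)
    qed
    have two: "a (p + 2) = a p" for p
    proof -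
      have "p + 2 + m + m = p + 2 + 2 * m" "p + 2 + m + 2 * m = p + 2 + 3 * m"
        "p + 2 + m + 3 * m = p + (4 * m + 2)" by simp_all
      then have "w (p + 2 + m) - w (p + 2) = a (p + (4 * m + 2)) - a (p + 2)"
        unfolding w_def by (simp only:)
      then have "even (a p - a (p + 2))"
        using per[of p] odd[of "p + 2 + m"] odd[of "p + 2"] by (metis odd_even_add diff_add_cancel even_add)
      then show ?thesis using a01[of p] a01[of "p + 2"] by auto
    qed
    have two': "a (p + 2 * j) = a p" for p j
      by (induction j) (use two in \<open>auto simp: ac_simps\<close>)
    have "w 0 = 2 * (a 0 + a m)"
      using two'[of 0 m] two'[of m m] by (simp add: w_def)
    then show False using odd[of 0] by simp
  qed
  moreover have "?e \<ge> 0" by (rule sum_nonneg) auto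
  ultimately show ?thesis using ev by presburger
qed

text \<open>This is the Erdos-Ko-Rado bound for arcs of \<open>m - 1\<close> points on a circle of \<open>2m\<close> points, where
arcs at distance \<open>m\<close> and \<open>m - 1\<close> are disjoint. The antipodal pairs alone give at most \<open>m\<close> ones.
If there were \<open>m\<close> of them, then both inequalities would be equalities throughout, so
\<open>a (p + m) = a (p + m - 1)\<close> for all \<open>p\<close>. The sequence would be constant, against
\<open>a p + a (p + m) = 1\<close>.\<close>

lemma cyclic_antipodal:
  fixes a :: "nat \<Rightarrow> int"
  assumes a01: "\<And>p. a p \<in> {0, 1}" and per: "\<And>p. a (p + 2 * m) = a p" and m: "m \<ge> 1"
    and anti: "\<And>p. a p + a (p + m) \<le> 1" and near: "\<And>p. a p + a (p + m - 1) \<le> 1"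
  shows "(\<Sum>p<2*m. a p) \<le> int m - 1"
proof (rule ccontr)
  let ?k = "\<Sum>p<2*m. a p"
  have sh: "(\<Sum>p<2*m. a (p + c)) = ?k" for c
    using sum_cyclic_shift[of a "2*m" c] per by simp
  have full: "\<forall>p<2*m. a p + a (p + c) = 1"
    if le: "\<And>p. a p + a (p + c) \<le> 1" and k: "?k \<ge> int m" for c
  proof -
    have "(\<Sum>p<2*m. 1 - (a p + a (p + c))) = 2 * int m - 2 * ?k"
      by (simp add: sum_subtractf sum.distrib sh)
    moreover have "(\<Sum>p<2*m. 1 - (a p + a (p + c))) \<ge> 0"
      by (rule sum_nonneg) (use le in auto)
    ultimately have "(\<Sum>p<2*m. 1 - (a p + a (p + c))) = 0" using k by linarith
    then show ?thesis by (subst (asm) sum_nonneg_eq_0_iff) (use le in auto)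
  qed
  assume "\<not> ?k \<le> int m - 1"
  then have k: "?k \<ge> int m" by linarith
  have near': "a p + a (p + (m - 1)) \<le> 1" for p using near[of p] m by simp
  have A: "a p + a (p + m) = 1" and B: "a p + a (p + (m - 1)) = 1" if "p < 2 * m" for p
    using full[OF anti k] full[OF near' k] that by auto
  have eq: "a (p + m) = a (p + (m - 1))" if "p < 2 * m" for p using A[OF that] B[OF that] by linarith
  \<comment> \<open>every step from \<open>m - 1\<close> on leaves the value unchanged; half a turn is enough for the contradiction\<close>
  have "a (m - 1 + j) = a (m - 1)" if "j \<le> 2 * m" for j
    using that
  proof (induction j)
    case (Suc j)
    then show ?case using eq[of j] m by (simp add: ac_simps)
  qed simp
  from this[of m] A[of "m - 1"] m show False by (auto simp: ac_simps) presburger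
qed

section \<open>Level m on the circle\<close>

text \<open>Read a circle of \<open>3m + 1\<close> points from \<open>p\<close> as three consecutive \<open>m\<close>-arcs and one leftover point. If
two of the arcs are members, then the third arc together with the leftover point is not a member.
Two kinds of missing sets suffice: for two adjacent member arcs the missing set is an arc again, up to rotation,
and for the first and third arc it is the middle arc with the leftover point.\<close>

lemma circle_three:
  assumes G: "upset_free 3 n G" and n: "n = 3 * m + 1" and m: "m \<ge> 1"
  shows "2 * (\<Sum>p<n. of_bool (rot n p {0..<m} \<in> G)) \<le>
    2 * real m + 2 * (\<Sum>p<n. of_bool (rot n p {2*m..<3*m+1} \<notin> G)) +
      (\<Sum>p<n. of_bool (rot n p (insert (3*m) {m..<2*m}) \<notin> G))"
proof -
  define a :: "nat \<Rightarrow> int" where "a = (\<lambda>p. of_bool (rot n p {0..<m} \<in> G))"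
  have a1: "a (p + m) = of_bool (rot n p {m..<2*m} \<in> G)"
    and a2: "a (p + 2*m) = of_bool (rot n p {2*m..<3*m} \<in> G)" for p
    using rot_add[of n p m 0 m] rot_add[of n p "2*m" 0 m] by (simp_all add: a_def mult_2[symmetric])
  have dis: "rot n p X \<inter> rot n p Y = {}" if "X \<subseteq> {..<n}" "Y \<subseteq> {..<n}" "X \<inter> Y = {}" for X Y p
    using that by (rule rot_disjoint)
  have "2 * (\<Sum>p<n. a p) \<le> 2 * int m + 2 * (\<Sum>p<n. a p * a (p + m)) + (\<Sum>p<n. a p * a (p + 2 * m))"
    unfolding n by (rule cyclic_three_windows) (use rot_period[of n] in \<open>auto simp: a_def n\<close>)
  also have "\<dots> \<le> 2 * int m + 2 * (\<Sum>p<n. of_bool (rot n p {2*m..<3*m+1} \<notin> G)) +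
      (\<Sum>p<n. of_bool (rot n p (insert (3*m) {m..<2*m}) \<notin> G))"
  proof (intro add_mono mult_left_mono sum_mono order_refl)
    fix p
    have "rot n p {2*m..<3*m+1} \<notin> G" if "rot n p {0..<m} \<in> G" "rot n p {m..<2*m} \<in> G"
    proof
      assume "rot n p {2*m..<3*m+1} \<in> G"
      from upset_free_three[OF G that this] show False by (rule; intro dis) (use n in auto)
    qed
    then show "a p * a (p + m) \<le> of_bool (rot n p {2*m..<3*m+1} \<notin> G)"
      unfolding a1 unfolding a_def of_bool_conj[symmetric] by (simp del: of_bool_conj)
    have "rot n p (insert (3*m) {m..<2*m}) \<notin> G"
      if "rot n p {0..<m} \<in> G" "rot n p {2*m..<3*m} \<in> G"
    proof
      assume "rot n p (insert (3*m) {m..<2*m}) \<in> G"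
      from upset_free_three[OF G that this] show False by (rule; intro dis) (use n m in auto)
    qed
    then show "a p * a (p + 2*m) \<le> of_bool (rot n p (insert (3*m) {m..<2*m}) \<notin> G)"
      unfolding a2 unfolding a_def of_bool_conj[symmetric] by (simp del: of_bool_conj)
  qed simp_all
  finally have "real_of_int (2 * (\<Sum>p<n. a p)) \<le> real_of_int (2 * int m +
      2 * (\<Sum>p<n. of_bool (rot n p {2*m..<3*m+1} \<notin> G)) +
      (\<Sum>p<n. of_bool (rot n p (insert (3*m) {m..<2*m}) \<notin> G)))"
    by (simp only: of_int_le_iff)
  then show ?thesis by (simp only: a_def of_int_add of_int_mult of_int_sum of_int_of_bool of_int_numeral of_int_of_nat_eq)
qed


text \<open>The letters say which of four disjoint \<open>m\<close>-sets are members, and the pairs such as \<open>ax\<close>, \<open>ay\<close>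
say that the set becomes a nonmember when the first or second leftover point is added. With three
member sets, both extensions of the fourth are missing. With two, the two ways to match the others
with the leftover points cost one missing set each, while the odd case \<open>k = 1\<close> needs none.\<close>

lemma four_window_count:
  assumes "\<not> (a \<and> b \<and> c \<and> d)"
    and "b \<and> c \<and> d \<longrightarrow> ax \<and> ay" "a \<and> c \<and> d \<longrightarrow> bx \<and> by'"
    and "a \<and> b \<and> d \<longrightarrow> cx \<and> cy" "a \<and> b \<and> c \<longrightarrow> dx \<and> dy"
    and "c \<and> d \<longrightarrow> (ax \<or> by') \<and> (ay \<or> bx)" "b \<and> d \<longrightarrow> (ax \<or> cy) \<and> (ay \<or> cx)"
    and "b \<and> c \<longrightarrow> (ax \<or> dy) \<and> (ay \<or> dx)" "a \<and> d \<longrightarrow> (bx \<or> cy) \<and> (by' \<or> cx)"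
    and "a \<and> c \<longrightarrow> (bx \<or> dy) \<and> (by' \<or> dx)" "a \<and> b \<longrightarrow> (cx \<or> dy) \<and> (cy \<or> dx)"
  defines "k \<equiv> of_bool a + of_bool b + of_bool c + of_bool d :: int"
  shows "k + of_bool (even k) \<le> 1 + (of_bool ax + of_bool ay + of_bool bx + of_bool by' +
      of_bool cx + of_bool cy + of_bool dx + of_bool dy)"
  using assms(1-11) unfolding k_def
  by (cases a; cases b; cases c; cases d; simp; force simp: of_bool_def)


text \<open>Each window of four consecutive \<open>m\<close>-arcs, with the two leftover points, has \<open>1\<close> plus its number of missing sets
at least the number of member arcs, with one to spare if the latter is even. At least two windows are
even, which is the summand 2 on the left.\<close>

lemma circle_four:
  assumes G: "upset_free 4 n G" and n: "n = 4 * m + 2" and m: "m \<ge> 1"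
  shows "4 * (\<Sum>p<n. of_bool (rot n p {0..<m} \<in> G)) + 2 \<le>
    real n + (\<Sum>p<n. \<Sum>i<4. \<Sum>j<2. of_bool (rot n p (insert (4*m+j) {i*m..<i*m+m}) \<notin> G))"
proof -
  define a :: "nat \<Rightarrow> int" where "a = (\<lambda>p. of_bool (rot n p {0..<m} \<in> G))"
  define w where "w = (\<lambda>p. a p + a (p + m) + a (p + 2 * m) + a (p + 3 * m))"
  define M :: "nat \<Rightarrow> int" where
    "M = (\<lambda>p. \<Sum>i<4. \<Sum>j<2. of_bool (rot n p (insert (4*m+j) {i*m..<i*m+m}) \<notin> G))"
  have sh: "(\<Sum>p<n. a (p + c)) = (\<Sum>p<n. a p)" for c
    by (rule sum_cyclic_shift) (simp add: a_def rot_period)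
  have even2: "(\<Sum>p<n. of_bool (even (w p))) \<ge> (2::int)"
    unfolding w_def n
    by (rule cyclic_four_windows) (use rot_period[of n] in \<open>auto simp: a_def n\<close>)
  have window: "w p + of_bool (even (w p)) \<le> 1 + M p" for p
  proof -
    define I where "I = (\<lambda>i. {i*m..<i*m+m})"
    define A where "A = (\<lambda>i. rot n p (I i))"
    define X where "X = (\<lambda>i j. rot n p (insert (4*m+j) (I i)))"
    have aA: "a (p + i * m) = of_bool (A i \<in> G)" for i
      using rot_add[of n p "i*m" 0 m] by (simp add: a_def A_def I_def)
    have w: "w p = of_bool (A 0 \<in> G) + of_bool (A 1 \<in> G) + of_bool (A 2 \<in> G) + of_bool (A 3 \<in> G)"
      using aA[of 0] aA[of 1] aA[of 2] aA[of 3] by (simp add: w_def)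
    have M: "M p = of_bool (X 0 0 \<notin> G) + of_bool (X 0 1 \<notin> G) + of_bool (X 1 0 \<notin> G) + of_bool (X 1 1 \<notin> G)
        + of_bool (X 2 0 \<notin> G) + of_bool (X 2 1 \<notin> G) + of_bool (X 3 0 \<notin> G) + of_bool (X 3 1 \<notin> G)"
      by (simp add: M_def X_def I_def eval_nat_numeral)
    have sep: "i * m + m \<le> j * m" if "i < j" for i j
      using mult_le_mono1[of "Suc i" j m] that by simp
    have I_sub: "I i \<subseteq> {..<4*m}" if "i < 4" for i
      using sep[OF that] unfolding I_def
      by (intro subsetI) (metis atLeastLessThan_iff lessThan_iff less_le_trans)
    have I_disj: "I i \<inter> I j = {}" if "i \<noteq> j" for i j
      using that sep[of i j] sep[of j i] by (cases i j rule: linorder_cases) (auto simp: I_def)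
    have I_n: "I i \<subseteq> {..<n}" and I_pt: "4 * m + l \<notin> I i" if "i < 4" for i l
      using I_sub[OF that] n by auto
    have pt_n: "4 * m + l < n" if "l < 2" for l using that n by simp
    have AA: "A i \<inter> A j = {}" if "i \<noteq> j" "i < 4" "j < 4" for i j
      unfolding A_def using that I_n I_disj by (intro rot_disjoint) auto
    have AX: "A i \<inter> X j l = {}" if "i \<noteq> j" "i < 4" "j < 4" "l < 2" for i j l
      unfolding A_def X_def using that I_n I_disj I_pt pt_n by (intro rot_disjoint) auto
    have XX: "X i k \<inter> X j l = {}" if "i \<noteq> j" "i < 4" "j < 4" "k \<noteq> l" "k < 2" "l < 2" for i j k l
      unfolding X_def using that I_n I_disj I_pt pt_n by (intro rot_disjoint) auto
    have all: "\<not> (A 0 \<in> G \<and> A 1 \<in> G \<and> A 2 \<in> G \<and> A 3 \<in> G)"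
      using upset_free_four[OF G, of "A 0" "A 1" "A 2" "A 3"] AA by auto
    have three: "X l c \<notin> G" if "A i \<in> G" "A j \<in> G" "A k \<in> G" "distinct [i, j, k, l]"
      "i < 4" "j < 4" "k < 4" "l < 4" "c < 2" for i j k l c
      using upset_free_four[OF G, of "A i" "A j" "A k" "X l c"] that AA AX by auto
    have two: "X k c \<notin> G \<or> X l d \<notin> G" if "A i \<in> G" "A j \<in> G" "distinct [i, j, k, l]"
      "i < 4" "j < 4" "k < 4" "l < 4" "c < 2" "d < 2" "c \<noteq> d" for i j k l c d
      using upset_free_four[OF G, of "A i" "A j" "X k c" "X l d"] that AA AX XX by auto
    show ?thesis unfolding w M
    proof (rule four_window_count[OF all])
      show "A 1 \<in> G \<and> A 2 \<in> G \<and> A 3 \<in> G \<longrightarrow> X 0 0 \<notin> G \<and> X 0 1 \<notin> G"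
        using three[of 1 2 3 0] by simp
      show "A 0 \<in> G \<and> A 2 \<in> G \<and> A 3 \<in> G \<longrightarrow> X 1 0 \<notin> G \<and> X 1 1 \<notin> G"
        using three[of 0 2 3 1] by simp
      show "A 0 \<in> G \<and> A 1 \<in> G \<and> A 3 \<in> G \<longrightarrow> X 2 0 \<notin> G \<and> X 2 1 \<notin> G"
        using three[of 0 1 3 2] by simp
      show "A 0 \<in> G \<and> A 1 \<in> G \<and> A 2 \<in> G \<longrightarrow> X 3 0 \<notin> G \<and> X 3 1 \<notin> G"
        using three[of 0 1 2 3] by simp
      show "A 2 \<in> G \<and> A 3 \<in> G \<longrightarrow> (X 0 0 \<notin> G \<or> X 1 1 \<notin> G) \<and> (X 0 1 \<notin> G \<or> X 1 0 \<notin> G)"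
        using two[of 2 3 0 1 0 1] two[of 2 3 0 1 1 0] by simp
      show "A 1 \<in> G \<and> A 3 \<in> G \<longrightarrow> (X 0 0 \<notin> G \<or> X 2 1 \<notin> G) \<and> (X 0 1 \<notin> G \<or> X 2 0 \<notin> G)"
        using two[of 1 3 0 2 0 1] two[of 1 3 0 2 1 0] by simp
      show "A 1 \<in> G \<and> A 2 \<in> G \<longrightarrow> (X 0 0 \<notin> G \<or> X 3 1 \<notin> G) \<and> (X 0 1 \<notin> G \<or> X 3 0 \<notin> G)"
        using two[of 1 2 0 3 0 1] two[of 1 2 0 3 1 0] by simp
      show "A 0 \<in> G \<and> A 3 \<in> G \<longrightarrow> (X 1 0 \<notin> G \<or> X 2 1 \<notin> G) \<and> (X 1 1 \<notin> G \<or> X 2 0 \<notin> G)"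
        using two[of 0 3 1 2 0 1] two[of 0 3 1 2 1 0] by simp
      show "A 0 \<in> G \<and> A 2 \<in> G \<longrightarrow> (X 1 0 \<notin> G \<or> X 3 1 \<notin> G) \<and> (X 1 1 \<notin> G \<or> X 3 0 \<notin> G)"
        using two[of 0 2 1 3 0 1] two[of 0 2 1 3 1 0] by simp
      show "A 0 \<in> G \<and> A 1 \<in> G \<longrightarrow> (X 2 0 \<notin> G \<or> X 3 1 \<notin> G) \<and> (X 2 1 \<notin> G \<or> X 3 0 \<notin> G)"
        using two[of 0 1 2 3 0 1] two[of 0 1 2 3 1 0] by simp
    qed
  qed
  have "(\<Sum>p<n. w p + of_bool (even (w p))) \<le> (\<Sum>p<n. 1 + M p)"
    by (rule sum_mono) (rule window)
  then have "4 * (\<Sum>p<n. a p) + 2 \<le> int n + (\<Sum>p<n. M p)"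
    using even2 by (simp add: w_def sum.distrib sh)
  then have "real_of_int (4 * (\<Sum>p<n. a p) + 2) \<le> real_of_int (int n + (\<Sum>p<n. M p))"
    by (simp only: of_int_le_iff)
  then show ?thesis
    by (simp only: a_def M_def of_int_add of_int_mult of_int_sum of_int_of_bool of_int_numeral of_int_of_nat_eq)
qed

section \<open>Levels below m\<close>

text \<open>If \<open>A\<close> and \<open>A - {0}\<close> are both members, then \<open>0\<close> is free to join \<open>B\<close> or \<open>C\<close>, and two sets must be missing
among \<open>B\<close>, \<open>C\<close> and their extensions by \<open>0\<close>. So the second lower level is paid for
without charging level \<open>m + 1\<close> twice. Keeping \<open>A \<in> G\<close> in the joint events is what permits the sharper estimate of
these events by \<open>circle_complement\<close>.\<close>

lemma chain_three:
  assumes G: "upset_free 3 n G" and n: "n = 3 * m + 1" and m: "m \<ge> 2"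
  defines "A \<equiv> {..<m-1}" and "B \<equiv> {m-1..<2*m}" and "C \<equiv> {2*m..<3*m+1}"
  shows "of_bool (A \<in> G) + of_bool (A - {0} \<in> G) \<le>
    of_bool (A \<in> G \<and> B \<notin> G) + of_bool (A \<in> G \<and> C \<notin> G) +
    of_bool (insert 0 B \<notin> G) + (of_bool (insert 0 C \<notin> G) :: real)"
proof -
  have ABC: "A \<inter> B = {}" "A \<inter> C = {}" "B \<inter> C = {}" "0 \<notin> B" "0 \<notin> C"
    using m by (auto simp: A_def B_def C_def)
  have "A \<subseteq> {..<n}" using m by (auto simp: A_def n)
  then have up: "A - {0} \<in> G \<Longrightarrow> A \<in> G" using upset_free_upD[OF G, of "A - {0}" A] by auto
  have ABC': "(A - {0}) \<inter> insert 0 B = {}" "(A - {0}) \<inter> C = {}" "insert 0 B \<inter> C = {}"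
      "(A - {0}) \<inter> B = {}" "(A - {0}) \<inter> insert 0 C = {}" "B \<inter> insert 0 C = {}"
    using ABC by blast+
  have 1: "B \<notin> G \<or> C \<notin> G" if "A \<in> G"
    using upset_free_three[OF G that _ _ ABC(1-3)] by blast
  have 2: "insert 0 B \<notin> G \<or> C \<notin> G" and 3: "B \<notin> G \<or> insert 0 C \<notin> G" if "A - {0} \<in> G"
    using upset_free_three[OF G that _ _ ABC'(1-3)] upset_free_three[OF G that _ _ ABC'(4-6)] by blast+
  show ?thesis
    using up 1 2 3
    by (cases "A \<in> G"; cases "A - {0} \<in> G"; cases "B \<in> G"; cases "C \<in> G") simp_all
qed

text \<open>No single set can be missing from all three triples obtained by adding \<open>0\<close> to one of \<open>B\<close>,
\<open>C\<close>, \<open>D\<close>. Hence \<open>A - {0} \<in> G\<close> forces two missing sets.\<close>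

lemma chain_four:
  assumes G: "upset_free 4 n G" and n: "n = 4 * m + 2" and m: "m \<ge> 2"
  defines "A \<equiv> {..<m-1}" and "B \<equiv> {m-1..<2*m}" and "C \<equiv> {2*m..<3*m+1}" and "D \<equiv> {3*m+1..<4*m+2}"
  shows "of_bool (A \<in> G) + of_bool (A - {0} \<in> G) \<le>
    of_bool (B \<notin> G) + of_bool (C \<notin> G) + of_bool (D \<notin> G) +
    of_bool (insert 0 B \<notin> G) + of_bool (insert 0 C \<notin> G) + (of_bool (insert 0 D \<notin> G) :: real)"
proof -
  have disj: "A \<inter> B = {}" "A \<inter> C = {}" "B \<inter> C = {}" "A \<inter> D = {}" "B \<inter> D = {}" "C \<inter> D = {}"
      "0 \<notin> B" "0 \<notin> C" "0 \<notin> D"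
    using m by (auto simp: A_def B_def C_def D_def)
  have "A \<subseteq> {..<n}" using m by (auto simp: A_def n)
  then have up: "A - {0} \<in> G \<Longrightarrow> A \<in> G" using upset_free_upD[OF G, of "A - {0}" A] by auto
  have disj': "(A - {0}) \<inter> B = {}" "(A - {0}) \<inter> C = {}" "(A - {0}) \<inter> D = {}"
      "(A - {0}) \<inter> insert 0 B = {}" "(A - {0}) \<inter> insert 0 C = {}" "(A - {0}) \<inter> insert 0 D = {}"
      "insert 0 B \<inter> C = {}" "insert 0 B \<inter> D = {}" "B \<inter> insert 0 C = {}" "insert 0 C \<inter> D = {}"
      "B \<inter> insert 0 D = {}" "C \<inter> insert 0 D = {}"
    using disj by blast+
  have 1: "B \<notin> G \<or> C \<notin> G \<or> D \<notin> G" if "A \<in> G"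
    using upset_free_four[OF G that _ _ _ disj(1,2,4,3,5,6)] by blast
  have 2: "insert 0 B \<notin> G \<or> C \<notin> G \<or> D \<notin> G" if "A - {0} \<in> G"
    using upset_free_four[OF G that _ _ _ disj'(4,2,3,7,8) disj(6)] by blast
  have 3: "B \<notin> G \<or> insert 0 C \<notin> G \<or> D \<notin> G" if "A - {0} \<in> G"
    using upset_free_four[OF G that _ _ _ disj'(1,5,3,9) disj(5) disj'(10)] by blast
  have 4: "B \<notin> G \<or> C \<notin> G \<or> insert 0 D \<notin> G" if "A - {0} \<in> G"
    using upset_free_four[OF G that _ _ _ disj'(1,2,6) disj(3) disj'(11,12)] by blast
  show ?thesis
    using up 1 2 3 4
    by (cases "A \<in> G"; cases "A - {0} \<in> G"; cases "B \<in> G"; cases "C \<in> G"; cases "D \<in> G") simp_all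
qed

text \<open>Fix a nonmember \<open>C\<close> of size \<open>m + 1\<close> and put its complement on a circle of \<open>2m\<close> points. Two disjoint member arcs of
size \<open>m - 1\<close> leave over two points \<open>y\<close>, \<open>z\<close>, and \<open>C\<close> stays a nonmember when both are added. So
if at most one point \<open>y\<close> has \<open>insert y C \<notin> G\<close>, then the member arcs intersect pairwise and
Erdos-Ko-Rado gives \<open>m - 1\<close> of them. Otherwise the antipodal pairs give at most \<open>m\<close> plus half the number
of such points, which is no worse.\<close>

lemma circle_complement:
  assumes G: "upset_free 3 n G" and n: "n = 3 * m + 1" and m: "m \<ge> 2"
  defines "C \<equiv> {2*m..<3*m+1}"
  shows "(\<Sum>t<2*m. of_bool (rot (2*m) t {0..<m-1} \<in> G \<and> C \<notin> G)) \<le>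
    (real m - 1) * of_bool (C \<notin> G) + (\<Sum>y<2*m. of_bool (insert y C \<notin> G))"
proof (cases "C \<in> G")
  case True
  then show ?thesis by (simp add: sum_nonneg)
next
  case False
  define a :: "nat \<Rightarrow> int" where "a = (\<lambda>p. of_bool (rot (2*m) p {0..<m-1} \<in> G))"
  define Y where "Y = {y. y < 2*m \<and> insert y C \<notin> G}"
  have finY: "finite Y" by (simp add: Y_def)
  have shift: "a (p + c) = of_bool (rot (2*m) p {c..<c+(m-1)} \<in> G)" for p c
    using rot_add[of "2*m" p c 0 "m-1"] by (simp add: a_def)
  have per: "a (p + 2*m) = a p" for p by (simp add: a_def rot_period)
  have sub: "rot (2*m) p X \<subseteq> {..<2*m}" for p X using m by (intro rot_subset) auto
  have missing: "(p + i) mod (2*m) \<in> Y \<and> (p + j) mod (2*m) \<in> Y"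
    if "rot (2*m) p X \<in> G" "rot (2*m) p Z \<in> G" "X \<inter> Z = {}" "X \<subseteq> {..<2*m}" "Z \<subseteq> {..<2*m}"
      "i < 2*m" "j < 2*m" "i \<noteq> j" "i \<notin> X \<union> Z" "j \<notin> X \<union> Z" for p X Z i j
  proof -
    let ?y = "(p + i) mod (2*m)" and ?z = "(p + j) mod (2*m)"
    have XZ: "rot (2*m) p X \<inter> rot (2*m) p Z = {}" using that by (intro rot_disjoint)
    have yz: "rot (2*m) p X \<inter> {?y, ?z} = {}" "rot (2*m) p Z \<inter> {?y, ?z} = {}"
      using rot_disjoint[of X "2*m" "{i, j}" p] rot_disjoint[of Z "2*m" "{i, j}" p] that
      by (simp_all add: rot_def)
    have C: "rot (2*m) p X \<inter> C = {}" "rot (2*m) p Z \<inter> C = {}"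
      using sub[THEN subsetD, of _ p] by (fastforce simp: C_def disjoint_iff)+
    have lt: "?y < 2*m" "?z < 2*m" using m by auto
    have notin: "insert ?y (insert ?z C) \<notin> G"
    proof
      assume "insert ?y (insert ?z C) \<in> G"
      from upset_free_three[OF G that(1,2) this XZ] yz C show False by simp
    qed
    have big: "insert ?y (insert ?z C) \<subseteq> {..<n}"
    proof -
      have "2 * m \<le> n" using n by simp
      from lt[THEN less_le_trans, OF this] show ?thesis using n by (auto simp: C_def)
    qed
    have "X' \<notin> G" if "X' \<subseteq> insert ?y (insert ?z C)" for X'
      using notin upset_free_upD[OF G _ that big] by (rule contrapos_nn)
    then have "insert ?y C \<notin> G" "insert ?z C \<notin> G" by (simp_all add: subset_insertI subset_insertI2)
    with lt show ?thesis by (simp add: Y_def)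
  qed
  have mem: "rot (2*m) p {c..<c+(m-1)} \<in> G" if "a (p + c) = 1" for p c
    using that shift[of p c] by simp
  have anti: "(p + (m - 1)) mod (2*m) \<in> Y \<and> (p + (2*m - 1)) mod (2*m) \<in> Y"
    if "a p = 1" "a (p + m) = 1" for p
    by (rule missing[OF mem[of p 0] mem[of p m]]) (use that m in auto)
  have near: "(p + (2*m - 2)) mod (2*m) \<in> Y \<and> (p + (2*m - 1)) mod (2*m) \<in> Y"
    if "a p = 1" "a (p + (m - 1)) = 1" for p
    by (rule missing[OF mem[of p 0] mem[of p "m-1"]]) (use that m in auto)
  have pts: "(p + i) mod (2*m) \<noteq> (p + j) mod (2*m)" if "i < 2*m" "j < 2*m" "i \<noteq> j" for p i j
    using inj_onD[OF inj_on_rot, of p i "2*m" j] that by auto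
  have a01: "a p \<in> {0, 1}" for p by (simp add: a_def)
  have main: "(\<Sum>p<2*m. a p) \<le> int m - 1 + int (card Y)"
  proof (cases "card Y \<le> 1")
    case True
    then have one: "u = v" if "u \<in> Y" "v \<in> Y" for u v
      using that finY by (metis card_le_Suc0_iff_eq One_nat_def)
    have "(\<Sum>p<2*m. a p) \<le> int m - 1"
    proof (rule cyclic_antipodal[of a m, OF a01 per])
      have both: "a p + a q \<le> 1" if "\<not> (a p = 1 \<and> a q = 1)" for p q
        using a01[of p] a01[of q] that by auto
      show "a p + a (p + m) \<le> 1" for p
      proof (rule both, rule notI, elim conjE)
        assume "a p = 1" "a (p + m) = 1"
        note Y = anti[OF this]
        have "(p + (m - 1)) mod (2*m) = (p + (2*m - 1)) mod (2*m)"
          by (rule one[OF conjunct1[OF Y] conjunct2[OF Y]])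
        moreover have "(p + (m - 1)) mod (2*m) \<noteq> (p + (2*m - 1)) mod (2*m)"
          by (rule pts) (use m in auto)
        ultimately show False by contradiction
      qed
      have "a p + a (p + (m - 1)) \<le> 1" for p
      proof (rule both, rule notI, elim conjE)
        assume "a p = 1" "a (p + (m - 1)) = 1"
        note Y = near[OF this]
        have "(p + (2*m - 2)) mod (2*m) = (p + (2*m - 1)) mod (2*m)"
          by (rule one[OF conjunct1[OF Y] conjunct2[OF Y]])
        moreover have "(p + (2*m - 2)) mod (2*m) \<noteq> (p + (2*m - 1)) mod (2*m)"
          by (rule pts) (use m in auto)
        ultimately show False by contradiction
      qed
      moreover have "p + m - 1 = p + (m - 1)" for p using m by simp
      ultimately show "a p + a (p + m - 1) \<le> 1" for p by simp
    qed (use m in auto)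
    then show ?thesis by linarith
  next
    case False
    define f :: "nat \<Rightarrow> int" where "f = (\<lambda>p. of_bool (p mod (2*m) \<in> Y))"
    have fper: "f (p + 2*m) = f p" for p by (simp add: f_def)
    have fsum: "(\<Sum>p<2*m. f (p + c)) = int (card Y)" for c
    proof -
      have "(\<Sum>p<2*m. f (p + c)) = (\<Sum>p<2*m. f p)" by (rule sum_cyclic_shift) (rule fper)
      also have "\<dots> = (\<Sum>p<2*m. of_bool (p \<in> Y))" by (simp add: f_def)
      also have "\<dots> = int (card ({..<2*m} \<inter> Y))" by simp
      also have "{..<2*m} \<inter> Y = Y" by (auto simp: Y_def)
      finally show ?thesis .
    qed
    have "(\<Sum>p<2*m. 2 * (a p + a (p + m))) \<le> (\<Sum>p<2*m. 2 + f (p + (m - 1)) + f (p + (2*m - 1)))"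
    proof (rule sum_mono)
      fix p
      show "2 * (a p + a (p + m)) \<le> 2 + f (p + (m - 1)) + f (p + (2*m - 1))"
        using anti[of p] a01[of p] a01[of "p + m"] by (auto simp: f_def)
    qed
    moreover have "(\<Sum>p<2*m. a (p + m)) = (\<Sum>p<2*m. a p)" by (rule sum_cyclic_shift) (rule per)
    moreover have "(\<Sum>p<2*m. 2 * (a p + a (p + m))) = 2 * ((\<Sum>p<2*m. a p) + (\<Sum>p<2*m. a (p + m)))"
      by (simp only: sum_distrib_left[symmetric] sum.distrib)
    moreover have "(\<Sum>p<2*m. 2 + f (p + (m - 1)) + f (p + (2*m - 1))) = 4 * int m + 2 * int (card Y)"
      by (simp only: sum.distrib fsum) simp
    ultimately have "2 * ((\<Sum>p<2*m. a p) + (\<Sum>p<2*m. a p)) \<le> 4 * int m + 2 * int (card Y)"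
      by (simp only:)
    moreover have "int (card Y) \<ge> 2" using False by simp
    ultimately show ?thesis by presburger
  qed
  have "(\<Sum>t<2*m. of_bool (rot (2*m) t {0..<m-1} \<in> G \<and> C \<notin> G)) = real_of_int (\<Sum>p<2*m. a p)"
    using False by (simp add: a_def)
  also have "\<dots> \<le> real_of_int (int m - 1 + int (card Y))" using main by (simp only: of_int_le_iff)
  also have "\<dots> = (real m - 1) * of_bool (C \<notin> G) + real (card Y)" using False by simp
  also have "real (card Y) = (\<Sum>y<2*m. of_bool (insert y C \<notin> G))"
    by (simp add: Y_def Int_def)
  finally show ?thesis .
qed

section \<open>Inequalities between the level densities\<close>

lemma mean_rot:
  assumes "F \<subseteq> Pow {..<n}" "n > 0" "X \<subseteq> {..<n}"
  shows "mean n F (\<lambda>G. of_bool (rot n p X \<in> G)) = density n F (card X)"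
    and "mean n F (\<lambda>G. of_bool (rot n p X \<notin> G)) = 1 - density n F (card X)"
  using mean_mem[OF assms(1) rot_subset[OF assms(2)]] mean_notmem[OF assms(1) rot_subset[OF assms(2)]]
  by (simp_all add: card_rot[OF assms(3)])

lemma density_middle_three:
  assumes F: "upset_free 3 n F" and n: "n = 3 * m + 1" and m: "m \<ge> 1"
  shows "2 * n * density n F m \<le> 2 * m + 3 * n * (1 - density n F (m + 1))"
proof -
  have P: "F \<subseteq> Pow {..<n}" using F by (simp add: upset_free_def)
  have "mean n F (\<lambda>G. 2 * (\<Sum>p<n. of_bool (rot n p {0..<m} \<in> G))) \<le>
      mean n F (\<lambda>G. 2 * real m + 2 * (\<Sum>p<n. of_bool (rot n p {2*m..<3*m+1} \<notin> G)) +
        (\<Sum>p<n. of_bool (rot n p (insert (3*m) {m..<2*m}) \<notin> G)))"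
    by (rule mean_mono[OF F]) (rule circle_three[OF _ n m])
  moreover have "mean n F (\<lambda>G. of_bool (rot n p {0..<m} \<in> G)) = density n F m"
      "mean n F (\<lambda>G. of_bool (rot n p {2*m..<3*m+1} \<notin> G)) = 1 - density n F (m + 1)"
      "mean n F (\<lambda>G. of_bool (rot n p (insert (3*m) {m..<2*m}) \<notin> G)) = 1 - density n F (m + 1)" for p
    using mean_rot[OF P, of "{0..<m}" p] mean_rot[OF P, of "{2*m..<3*m+1}" p]
      mean_rot[OF P, of "insert (3*m) {m..<2*m}" p] n m by (auto simp: subset_iff)
  ultimately show ?thesis
    by (simp only: mean_add mean_cmult mean_sum mean_const) (simp add: algebra_simps)
qed

lemma density_middle_four:
  assumes F: "upset_free 4 n F" and n: "n = 4 * m + 2" and m: "m \<ge> 1"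
  shows "4 * n * density n F m + 2 \<le> n + 8 * n * (1 - density n F (m + 1))"
proof -
  have P: "F \<subseteq> Pow {..<n}" using F by (simp add: upset_free_def)
  have "mean n F (\<lambda>G. 4 * (\<Sum>p<n. of_bool (rot n p {0..<m} \<in> G)) + 2) \<le>
    mean n F (\<lambda>G. real n + (\<Sum>p<n. \<Sum>i<4. \<Sum>j<2. of_bool (rot n p (insert (4*m+j) {i*m..<i*m+m}) \<notin> G)))"
    by (rule mean_mono[OF F]) (rule circle_four[OF _ n m])
  moreover have "mean n F (\<lambda>G. of_bool (rot n p {0..<m} \<in> G)) = density n F m" for p
    using mean_rot[OF P, of "{0..<m}" p] n by (auto simp: subset_iff)
  moreover have "mean n F (\<lambda>G. of_bool (rot n p (insert (4*m+j) {i*m..<i*m+m}) \<notin> G))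
      = 1 - density n F (m + 1)" if "i < 4" "j < 2" for p i j
  proof -
    have "i * m + m \<le> 4 * m" using mult_le_mono1[of "Suc i" 4 m] that by simp
    then have "{i*m..<i*m+m} \<subseteq> {..<4*m}"
      by (intro subsetI) (metis atLeastLessThan_iff lessThan_iff less_le_trans)
    then have "insert (4*m+j) {i*m..<i*m+m} \<subseteq> {..<n}" "4 * m + j \<notin> {i*m..<i*m+m}"
      using \<open>j < 2\<close> n by (force simp: subset_iff)+
    then show ?thesis using mean_rot(2)[OF P, of "insert (4*m+j) {i*m..<i*m+m}" p] n by simp
  qed
  then have "(\<Sum>p<n. \<Sum>i<4. \<Sum>j<2.
      mean n F (\<lambda>G. of_bool (rot n p (insert (4*m+j) {i*m..<i*m+m}) \<notin> G)))
    = (\<Sum>p<n. \<Sum>i<4::nat. \<Sum>j<2::nat. 1 - density n F (m + 1))"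
    by (intro sum.cong refl) auto
  ultimately show ?thesis
    by (simp only: mean_add mean_cmult mean_sum mean_const, simp, simp add: algebra_simps)
qed

text \<open>The probability that \<open>A\<close> is a member while a disjoint \<open>(m+1)\<close>-set is not is the same for all such pairs,
so the events with \<open>B\<close> and with \<open>C\<close> in \<open>chain_three\<close> are equally likely, and their probability can be
averaged over the arcs of \<open>circle_complement\<close>.\<close>

lemma density_low_three:
  assumes F: "upset_free 3 n F" and n: "n = 3 * m + 1" and m: "m \<ge> 2"
  shows "m * (density n F (m - 1) + density n F (m - 2)) \<le>
    (real m - 1) * (1 - density n F (m + 1)) + 4 * m * (1 - density n F (m + 2))"
proof -
  have P: "F \<subseteq> Pow {..<n}" using F by (simp add: upset_free_def)
  define A B C :: "nat set" where "A = {..<m-1}" and "B = {m-1..<2*m}" and "C = {2*m..<3*m+1}"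
  let ?q = "mean n F (\<lambda>G. of_bool (A \<in> G \<and> C \<notin> G))"
  have sub: "A \<subseteq> {..<n}" "B \<subseteq> {..<n}" "C \<subseteq> {..<n}" and n0: "0 < n"
    using m n by (auto simp: A_def B_def C_def)
  have card: "card A = m - 1" "card (A - {0}) = m - 2" "card B = m + 1" "card C = m + 1"
      "card (insert 0 B) = m + 2" "card (insert 0 C) = m + 2"
    using m by (auto simp: A_def B_def C_def card_insert_if)
  have "mean n F (\<lambda>G. of_bool (A \<in> G) + of_bool (A - {0} \<in> G)) \<le>
      mean n F (\<lambda>G. of_bool (A \<in> G \<and> B \<notin> G) + of_bool (A \<in> G \<and> C \<notin> G) +
        of_bool (insert 0 B \<notin> G) + of_bool (insert 0 C \<notin> G))"
    unfolding A_def B_def C_def by (rule mean_mono[OF F]) (rule chain_three[OF _ n m])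
  moreover have "mean n F (\<lambda>G. of_bool (A \<in> G \<and> B \<notin> G)) = ?q"
    by (rule mean_pair_cong[where \<phi> = "\<lambda>a b. of_bool (a \<and> \<not> b)"])
      (use sub card m in \<open>auto simp: A_def B_def C_def\<close>)
  moreover have "mean n F (\<lambda>G. of_bool (A \<in> G)) = density n F (m - 1)"
      "mean n F (\<lambda>G. of_bool (A - {0} \<in> G)) = density n F (m - 2)"
      "mean n F (\<lambda>G. of_bool (insert 0 B \<notin> G)) = 1 - density n F (m + 2)"
      "mean n F (\<lambda>G. of_bool (insert 0 C \<notin> G)) = 1 - density n F (m + 2)"
    using mean_mem[OF P, of A] mean_mem[OF P, of "A - {0}"] mean_notmem[OF P, of "insert 0 B"]
      mean_notmem[OF P, of "insert 0 C"] sub n0 card by (auto simp: subset_iff)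
  ultimately have 1: "density n F (m - 1) + density n F (m - 2) \<le> 2 * ?q + 2 * (1 - density n F (m + 2))"
    by (simp only: mean_add) simp
  have "mean n F (\<lambda>G. \<Sum>t<2*m. of_bool (rot (2*m) t {0..<m-1} \<in> G \<and> C \<notin> G)) \<le>
      mean n F (\<lambda>G. (real m - 1) * of_bool (C \<notin> G) + (\<Sum>y<2*m. of_bool (insert y C \<notin> G)))"
    unfolding C_def by (rule mean_mono[OF F]) (rule circle_complement[OF _ n m])
  moreover have "mean n F (\<lambda>G. of_bool (rot (2*m) t {0..<m-1} \<in> G \<and> C \<notin> G)) = ?q" for t
  proof -
    have r: "rot (2*m) t {0..<m-1} \<subseteq> {..<2*m}" using m by (intro rot_subset) auto
    then have r1: "rot (2*m) t {0..<m-1} \<subseteq> {..<n}" using n by (auto simp: subset_iff)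
    have r2: "rot (2*m) t {0..<m-1} \<inter> C = {}" using r by (auto simp: C_def)
    have r3: "card (rot (2*m) t {0..<m-1}) = card A" using m by (subst card_rot) (auto simp: A_def)
    show ?thesis
      by (rule mean_pair_cong[where \<phi> = "\<lambda>a b. of_bool (a \<and> \<not> b)", OF r1 sub(1) r3 sub(3) sub(3) refl r2])
        (use m in \<open>auto simp: A_def C_def\<close>)
  qed
  moreover have "mean n F (\<lambda>G. of_bool (C \<notin> G)) = 1 - density n F (m + 1)"
    using mean_notmem[OF P sub(3)] card by simp
  moreover have "mean n F (\<lambda>G. of_bool (insert y C \<notin> G)) = 1 - density n F (m + 2)" if "y < 2*m" for y
  proof -
    have "insert y C \<subseteq> {..<n}" "y \<notin> C" using that sub(3) n by (auto simp: C_def)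
    then show ?thesis using mean_notmem[OF P, of "insert y C"] card by (simp add: C_def)
  qed
  ultimately have 2: "2 * m * ?q \<le> (real m - 1) * (1 - density n F (m + 1)) + 2 * m * (1 - density n F (m + 2))"
    by (simp only: mean_add mean_cmult mean_sum mean_const) simp
  have "m * (density n F (m - 1) + density n F (m - 2)) \<le> m * (2 * ?q + 2 * (1 - density n F (m + 2)))"
    using 1 by (intro mult_left_mono) auto
  with 2 show ?thesis by (simp add: algebra_simps)
qed

lemma density_low_four:
  assumes F: "upset_free 4 n F" and n: "n = 4 * m + 2" and m: "m \<ge> 2"
  shows "density n F (m - 1) + density n F (m - 2) \<le>
    3 * (1 - density n F (m + 1)) + 3 * (1 - density n F (m + 2))"
proof -
  have P: "F \<subseteq> Pow {..<n}" using F by (simp add: upset_free_def)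
  define A B C D :: "nat set" where "A = {..<m-1}" and "B = {m-1..<2*m}"
    and "C = {2*m..<3*m+1}" and "D = {3*m+1..<4*m+2}"
  have sub: "A \<subseteq> {..<n}" "B \<subseteq> {..<n}" "C \<subseteq> {..<n}" "D \<subseteq> {..<n}" and n0: "0 < n"
    using m n by (auto simp: A_def B_def C_def D_def)
  have card: "card A = m - 1" "card (A - {0}) = m - 2" "card B = m + 1" "card C = m + 1" "card D = m + 1"
      "card (insert 0 B) = m + 2" "card (insert 0 C) = m + 2" "card (insert 0 D) = m + 2"
    using m by (auto simp: A_def B_def C_def D_def card_insert_if)
  have "mean n F (\<lambda>G. of_bool (A \<in> G) + of_bool (A - {0} \<in> G)) \<le>
      mean n F (\<lambda>G. of_bool (B \<notin> G) + of_bool (C \<notin> G) + of_bool (D \<notin> G) +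
        of_bool (insert 0 B \<notin> G) + of_bool (insert 0 C \<notin> G) + of_bool (insert 0 D \<notin> G))"
    unfolding A_def B_def C_def D_def by (rule mean_mono[OF F]) (rule chain_four[OF _ n m])
  moreover have "mean n F (\<lambda>G. of_bool (A \<in> G)) = density n F (m - 1)"
      "mean n F (\<lambda>G. of_bool (A - {0} \<in> G)) = density n F (m - 2)"
      "mean n F (\<lambda>G. of_bool (B \<notin> G)) = 1 - density n F (m + 1)"
      "mean n F (\<lambda>G. of_bool (C \<notin> G)) = 1 - density n F (m + 1)"
      "mean n F (\<lambda>G. of_bool (D \<notin> G)) = 1 - density n F (m + 1)"
      "mean n F (\<lambda>G. of_bool (insert 0 B \<notin> G)) = 1 - density n F (m + 2)"
      "mean n F (\<lambda>G. of_bool (insert 0 C \<notin> G)) = 1 - density n F (m + 2)"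
      "mean n F (\<lambda>G. of_bool (insert 0 D \<notin> G)) = 1 - density n F (m + 2)"
    using mean_mem[OF P, of A] mean_mem[OF P, of "A - {0}"] mean_notmem[OF P, of "insert 0 B"]
      mean_notmem[OF P, of "insert 0 C"] mean_notmem[OF P, of "insert 0 D"]
      mean_notmem[OF P, of B] mean_notmem[OF P, of C] mean_notmem[OF P, of D] sub n0 card
    by (auto simp: subset_iff)
  ultimately show ?thesis by (simp only: mean_add) simp
qed

section \<open>The upper bound\<close>

lemma binomial_step: "(k + 1) * (n choose (k + 1)) = (n - k) * (n choose k)"
  using binomial_absorption[of k n] binomial_absorb_comp[of n k] by simp

text \<open>Below a third of \<open>n\<close> the binomial coefficients at least double from one level to the next.\<close>

lemma sum_small_binomials_le: "3 * j \<le> n + 1 \<Longrightarrow> (\<Sum>k<j. n choose k) \<le> n choose j"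
proof (induction j)
  case (Suc j)
  have "(\<Sum>k<Suc j. n choose k) \<le> 2 * (n choose j)" using Suc by simp
  also have "\<dots> \<le> n choose Suc j"
  proof -
    have "Suc j * (2 * (n choose j)) \<le> (n - j) * (n choose j)"
      using mult_le_mono1[of "2 * Suc j" "n - j" "n choose j"] Suc.prems by (simp add: algebra_simps)
    also have "\<dots> = Suc j * (n choose Suc j)" using binomial_step[of j n] by simp
    finally show ?thesis by (simp only: Suc_mult_le_cancel1)
  qed
  finally show ?case .
qed simp

lemma card_eq_sum_density:
  assumes "F \<subseteq> Pow {..<n}"
  shows "real (card F) = (\<Sum>k\<le>n. (n choose k) * density n F k)"
proof -
  have fin: "finite F" using assms by (rule finite_subset) simp
  have le: "card A \<le> n" if "A \<in> F" for A
    using card_mono[of "{..<n}" A] that assms by auto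
  have "card F = (\<Sum>k\<le>n. card (level F k))"
  proof -
    have "F = (\<Union>k\<le>n. level F k)" using le by (auto simp: level_def)
    moreover have "card (\<Union>k\<le>n. level F k) = (\<Sum>k\<le>n. card (level F k))"
      using fin by (intro card_UN_disjoint) (auto simp: level_def)
    ultimately show ?thesis by simp
  qed
  then show ?thesis by (simp add: density_def)
qed

lemma upset_free_no_empty:
  assumes "upset_free s n F"
  shows "{} \<notin> F"
  using assms by (auto simp: upset_free_def disjoint_family_on_def dest: spec[of _ "\<lambda>_. {}"])

text \<open>The levels below \<open>m - 1\<close> are charged to level \<open>m - 2\<close>, as densities increase and the sum of
the binomial coefficients is at most \<open>n choose (m - 1)\<close>. The case \<open>m = 1\<close> is separate, because \<open>m - 2\<close> would be truncated;
there the only lower level is the empty set, which is not a member.\<close>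

lemma card_le_levels:
  fixes L :: real
  assumes F: "upset_free s n F" and m: "m \<ge> 1" and nm: "3 * m + 1 \<le> n"
  defines "L \<equiv> if m = 1 then 0 else density n F (m - 1) + density n F (m - 2)"
  shows "card F \<le> (n choose (m - 1)) * L + (n choose m) * density n F m +
    (n choose (m + 1)) * density n F (m + 1) + (n choose (m + 2)) * density n F (m + 2) +
    (\<Sum>k = m + 3..n. real (n choose k))"
proof -
  have P: "F \<subseteq> Pow {..<n}" using F by (simp add: upset_free_def)
  let ?t = "\<lambda>k. (n choose k) * density n F k"
  have low: "(\<Sum>k<m. ?t k) \<le> (n choose (m - 1)) * L"
  proof (cases "m = 1")
    case True
    have "level F 0 = {}"
    proof -
      have "finite A" if "A \<in> F" for A using that P finite_subset[of A "{..<n}"] by auto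
      then show ?thesis using upset_free_no_empty[OF F] by (auto simp: level_def card_eq_0_iff)
    qed
    then show ?thesis using True by (simp add: L_def density_def)
  next
    case False
    then obtain j where j: "m = Suc (Suc j)" using m by (metis One_nat_def not0_implies_Suc not_one_le_zero)
    have "(\<Sum>k<Suc j. ?t k) \<le> (\<Sum>k<Suc j. (n choose k) * density n F j)"
      using j nm by (intro sum_mono mult_left_mono density_mono[OF F]) auto
    also have "\<dots> = real (\<Sum>k<Suc j. n choose k) * density n F j"
      by (simp only: sum_distrib_right of_nat_sum)
    also have "\<dots> \<le> (n choose Suc j) * density n F j"
      using sum_small_binomials_le[of "Suc j" n] j nm
      by (intro mult_right_mono) (auto simp: density_def simp del: of_nat_sum)
    finally show ?thesis using j by (simp add: L_def algebra_simps)
  qed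
  have "real (card F) = (\<Sum>k\<le>n. ?t k)" by (rule card_eq_sum_density[OF P])
  also have "{..n} = {..<m} \<union> ({m, m + 1, m + 2} \<union> {m + 3..n})" using nm m by auto
  also have "sum ?t \<dots> = (\<Sum>k<m. ?t k) + (?t m + ?t (m + 1) + ?t (m + 2) + (\<Sum>k = m + 3..n. ?t k))"
    by (subst sum.union_disjoint, simp, simp, force)+ (simp add: add.assoc)
  also have "(\<Sum>k = m + 3..n. ?t k) \<le> (\<Sum>k = m + 3..n. real (n choose k))"
    using density_le_1[OF P] by (intro sum_mono) (auto intro!: mult_left_le)
  finally show ?thesis using low by linarith
qed


lemma sum_first_two:
  fixes f :: "nat \<Rightarrow> real"
  assumes "m + 2 \<le> n"
  shows "sum f {m + 1..n} = f (m + 1) + f (m + 2) + sum f {m + 3..n}"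
  using assms sum.atLeast_Suc_atMost[of "m + 1" n f] sum.atLeast_Suc_atMost[of "m + 2" n f]
  by (simp add: eval_nat_numeral)

text \<open>With \<open>u = (n choose (m - 1)) / m\<close>, the coefficients of the levels \<open>m - 1\<close>, \<open>m\<close> and \<open>m + 1\<close>
are \<open>m u\<close>, \<open>(2m + 2) u\<close> and \<open>(4m + 2) u\<close>. A deficit \<open>b1\<close> of level \<open>m + 1\<close> lets level \<open>m\<close> exceed the star
by \<open>3/2 (2m + 2) u b1\<close> and the lower levels contribute \<open>(m - 1) u b1\<close>. These add up to
exactly \<open>(4m + 2) u b1\<close>, which is what level \<open>m + 1\<close> loses. The deficit \<open>b2\<close> of level \<open>m + 2\<close> is
covered with room to spare.\<close>

lemma card_upset_free_three:
  assumes F: "upset_free 3 n F" and n: "n = 3 * m + 1" and m: "m \<ge> 1"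
  shows "real (card F) \<le> ((n - 1) choose (m - 1)) + (\<Sum>t = m + 1..n. real (n choose t))"
proof -
  define L where "L = (if m = 1 then 0 else density n F (m - 1) + density n F (m - 2))"
  define b1 b2 where "b1 = 1 - density n F (m + 1)" and "b2 = 1 - density n F (m + 2)"
  define u where "u = real (n choose (m - 1)) / m"
  have P: "F \<subseteq> Pow {..<n}" using F by (simp add: upset_free_def)
  have b: "b1 \<ge> 0" "b2 \<ge> 0" using density_le_1[OF P] n m by (simp_all add: b1_def b2_def)
  have u: "u \<ge> 0" by (simp add: u_def)
  have c1: "real (n choose (m - 1)) = m * u" using m by (simp add: u_def)
  have "real (m * (n choose m)) = real ((2 * m + 2) * (n choose (m - 1)))"
    using binomial_step[of "m - 1" n] m n by simp
  then have "real m * real (n choose m) = real (2 * m + 2) * real (n choose (m - 1))"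
    by (simp only: of_nat_mult)
  then have "real m * real (n choose m) = real m * ((2 * m + 2) * u)"
    unfolding c1 by (simp add: algebra_simps)
  then have c0: "real (n choose m) = (2 * m + 2) * u" using m by simp
  have "real ((m + 1) * (n choose (m + 1))) = real ((2 * m + 1) * (n choose m))"
    using binomial_step[of m n] n by simp
  then have "real (m + 1) * real (n choose (m + 1)) = real (m + 1) * ((4 * m + 2) * u)"
    by (simp add: c0 algebra_simps)
  then have X: "real (n choose (m + 1)) = (4 * m + 2) * u" by simp
  have "(m + 2) * (n choose (m + 2)) = 2 * m * (n choose (m + 1))"
    using binomial_step[of "m + 1" n] n by (simp add: numeral_2_eq_2)
  then have "real ((m + 2) * (n choose (m + 2))) = real (2 * m * (n choose (m + 1)))"
    by (simp only:)
  then have "real (m + 2) * real (n choose (m + 2)) = real (2 * m) * real (n choose (m + 1))"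
    by (simp only: of_nat_mult)
  then have "real (m + 2) * real (n choose (m + 2)) = 2 * m * ((4 * m + 2) * u)"
    unfolding X by simp
  also have "\<dots> \<ge> real (m + 2) * (4 * m * u)"
  proof -
    have "real (m + 2) * (4 * m * u) = (4 * m * (m + 2)) * u" by (simp add: algebra_simps)
    also have "\<dots> \<le> (4 * m * (2 * m + 1)) * u"
      using m u by (intro mult_right_mono mult_left_mono) auto
    finally show ?thesis by (simp add: algebra_simps)
  qed
  finally have c2: "real (n choose (m + 2)) \<ge> 4 * m * u" by simp
  have "real n * real ((n - 1) choose (m - 1)) = m * real (n choose m)"
    using binomial_absorption[of "m - 1" n] m by (simp flip: of_nat_mult)
  moreover have "real (n choose m) * (2 * n * density n F m) \<le> real (n choose m) * (2 * m + 3 * n * b1)"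
    using density_middle_three[OF F n m] by (intro mult_left_mono) (simp_all add: b1_def)
  ultimately have "real n * (2 * (real (n choose m) * density n F m)) \<le>
      real n * (2 * real ((n - 1) choose (m - 1)) + 3 * real (n choose m) * b1)"
    by (simp add: algebra_simps)
  then have mid: "2 * (real (n choose m) * density n F m) \<le>
      2 * real ((n - 1) choose (m - 1)) + 3 * real (n choose m) * b1"
    using n by simp
  have "m * L \<le> (real m - 1) * b1 + 4 * m * b2"
    using density_low_three[OF F n] m b by (cases "m = 1") (auto simp: L_def b1_def b2_def)
  then have "u * (m * L) \<le> u * ((real m - 1) * b1 + 4 * m * b2)"
    using u by (rule mult_left_mono)
  moreover have "4 * m * u * b2 \<le> real (n choose (m + 2)) * b2"
    using c2 b(2) by (rule mult_right_mono)
  ultimately have low: "real (n choose (m - 1)) * L \<le> u * (real m - 1) * b1 + real (n choose (m + 2)) * b2"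
    unfolding c1 by (simp add: algebra_simps)
  have "real (card F) \<le> (n choose (m - 1)) * L + (n choose m) * density n F m +
    (n choose (m + 1)) * density n F (m + 1) + (n choose (m + 2)) * density n F (m + 2) +
    (\<Sum>k = m + 3..n. real (n choose k))"
    unfolding L_def using n m by (intro card_le_levels[OF F]) auto
  also have "\<dots> = (n choose (m - 1)) * L + (n choose m) * density n F m +
    (n choose (m + 1)) * (1 - b1) + (n choose (m + 2)) * (1 - b2) +
    (\<Sum>k = m + 3..n. real (n choose k))" by (simp add: b1_def b2_def)
  also have "\<dots> \<le> real ((n - 1) choose (m - 1)) + real (n choose (m + 1)) + real (n choose (m + 2)) +
    (\<Sum>k = m + 3..n. real (n choose k))"
    using low mid unfolding c0 X by (simp add: algebra_simps)
  also have "\<dots> = ((n - 1) choose (m - 1)) + (\<Sum>t = m + 1..n. real (n choose t))"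
    using sum_first_two[of m n "\<lambda>t. real (n choose t)"] n m by simp
  finally show ?thesis .
qed

text \<open>As for three, with coefficients \<open>m u\<close>, \<open>(3m + 3) u\<close> and \<open>(9m + 6) u\<close>: the gains
\<open>2 (3m + 3) u b1\<close> and \<open>3 m u b1\<close> add up to the loss \<open>(9m + 6) u b1\<close>.\<close>

lemma card_upset_free_four:
  assumes F: "upset_free 4 n F" and n: "n = 4 * m + 2" and m: "m \<ge> 1"
  shows "real (card F) \<le> ((n - 1) choose (m - 1)) + (\<Sum>t = m + 1..n. real (n choose t))"
proof -
  define L where "L = (if m = 1 then 0 else density n F (m - 1) + density n F (m - 2))"
  define b1 b2 where "b1 = 1 - density n F (m + 1)" and "b2 = 1 - density n F (m + 2)"
  define u where "u = real (n choose (m - 1)) / m"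
  have P: "F \<subseteq> Pow {..<n}" using F by (simp add: upset_free_def)
  have b: "b1 \<ge> 0" "b2 \<ge> 0" using density_le_1[OF P] n m by (simp_all add: b1_def b2_def)
  have u: "u \<ge> 0" by (simp add: u_def)
  have c1: "real (n choose (m - 1)) = m * u" using m by (simp add: u_def)
  have "real (m * (n choose m)) = real ((3 * m + 3) * (n choose (m - 1)))"
    using binomial_step[of "m - 1" n] m n by simp
  then have "real m * real (n choose m) = real (3 * m + 3) * real (n choose (m - 1))"
    by (simp only: of_nat_mult)
  then have "real m * real (n choose m) = real m * ((3 * m + 3) * u)"
    unfolding c1 by (simp add: algebra_simps)
  then have c0: "real (n choose m) = (3 * m + 3) * u" using m by simp
  have "real ((m + 1) * (n choose (m + 1))) = real ((3 * m + 2) * (n choose m))"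
    using binomial_step[of m n] n by simp
  then have "real (m + 1) * real (n choose (m + 1)) = real (m + 1) * ((9 * m + 6) * u)"
    by (simp add: c0 algebra_simps)
  then have X: "real (n choose (m + 1)) = (9 * m + 6) * u" by simp
  have "(m + 2) * (n choose (m + 2)) = (3 * m + 1) * (n choose (m + 1))"
    using binomial_step[of "m + 1" n] n by (simp add: numeral_2_eq_2)
  then have "real ((m + 2) * (n choose (m + 2))) = real ((3 * m + 1) * (n choose (m + 1)))"
    by (simp only:)
  then have "real (m + 2) * real (n choose (m + 2)) = real (3 * m + 1) * real (n choose (m + 1))"
    by (simp only: of_nat_mult)
  then have "real (m + 2) * real (n choose (m + 2)) = (3 * m + 1) * ((9 * m + 6) * u)"
    unfolding X by simp
  also have "\<dots> \<ge> real (m + 2) * (3 * m * u)"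
  proof -
    have "real (m + 2) * (3 * m * u) = ((m + 2) * (3 * m)) * u" by (simp add: algebra_simps)
    also have "\<dots> \<le> ((3 * m + 1) * (9 * m + 6)) * u"
    proof -
      have "(m + 2) * (3 * m) \<le> (3 * m + 1) * (9 * m + 6)" using m by (intro mult_le_mono) auto
      then show ?thesis using u by (intro mult_right_mono) (simp_all only: of_nat_le_iff)
    qed
    finally show ?thesis by (simp add: algebra_simps)
  qed
  finally have c2: "real (n choose (m + 2)) \<ge> 3 * m * u" by simp
  have "real n * real ((n - 1) choose (m - 1)) = m * real (n choose m)"
    using binomial_absorption[of "m - 1" n] m by (simp flip: of_nat_mult)
  moreover have "real (n choose m) * (4 * n * density n F m) \<le> real (n choose m) * (4 * m + 8 * n * b1)"
    using density_middle_four[OF F n m] n by (intro mult_left_mono) (simp_all add: b1_def)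
  ultimately have "real n * (real (n choose m) * density n F m) \<le>
      real n * (real ((n - 1) choose (m - 1)) + 2 * real (n choose m) * b1)"
    by (simp add: algebra_simps)
  then have mid: "real (n choose m) * density n F m \<le>
      real ((n - 1) choose (m - 1)) + 2 * real (n choose m) * b1"
    using n by simp
  have "L \<le> 3 * b1 + 3 * b2"
    using density_low_four[OF F n] m b by (cases "m = 1") (auto simp: L_def b1_def b2_def)
  then have "m * u * L \<le> m * u * (3 * b1 + 3 * b2)"
    using u by (intro mult_left_mono) auto
  moreover have "3 * m * u * b2 \<le> real (n choose (m + 2)) * b2"
    using c2 b(2) by (rule mult_right_mono)
  ultimately have low: "real (n choose (m - 1)) * L \<le> 3 * m * u * b1 + real (n choose (m + 2)) * b2"
    unfolding c1 by (simp add: algebra_simps)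
  have "real (card F) \<le> (n choose (m - 1)) * L + (n choose m) * density n F m +
    (n choose (m + 1)) * density n F (m + 1) + (n choose (m + 2)) * density n F (m + 2) +
    (\<Sum>k = m + 3..n. real (n choose k))"
    unfolding L_def using n m by (intro card_le_levels[OF F]) auto
  also have "\<dots> = (n choose (m - 1)) * L + (n choose m) * density n F m +
    (n choose (m + 1)) * (1 - b1) + (n choose (m + 2)) * (1 - b2) +
    (\<Sum>k = m + 3..n. real (n choose k))" by (simp add: b1_def b2_def)
  also have "\<dots> \<le> real ((n - 1) choose (m - 1)) + real (n choose (m + 1)) + real (n choose (m + 2)) +
    (\<Sum>k = m + 3..n. real (n choose k))"
    using low mid unfolding c0 X by (simp add: algebra_simps)
  also have "\<dots> = ((n - 1) choose (m - 1)) + (\<Sum>t = m + 1..n. real (n choose t))"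
    using sum_first_two[of m n "\<lambda>t. real (n choose t)"] n m by simp
  finally show ?thesis .
qed

section \<open>From arbitrary families to upward closed ones\<close>

lemma finite_matching_sizes:
  assumes "finite F"
  shows "finite {card M | M. M \<subseteq> F \<and> disjoint M}" "{card M | M. M \<subseteq> F \<and> disjoint M} \<noteq> {}"
proof -
  have "{card M | M. M \<subseteq> F \<and> disjoint M} \<subseteq> card ` Pow F" by auto
  then show "finite {card M | M. M \<subseteq> F \<and> disjoint M}" using assms finite_subset by blast
  have "0 \<in> {card M | M. M \<subseteq> F \<and> disjoint M}" by (auto intro!: exI[of _ "{}"])
  then show "{card M | M. M \<subseteq> F \<and> disjoint M} \<noteq> {}" by blast
qed

lemma matching_number_less_iff:
  assumes "finite F"
  shows "matching_number F < s \<longleftrightarrow> (\<forall>M \<subseteq> F. disjoint M \<longrightarrow> card M < s)"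
  unfolding matching_number_def using finite_matching_sizes[OF assms] by (subst Max_less_iff) auto

text \<open>The up-closure of a family containing the empty set would be everything, so that member has to be exchanged first. It
is disjoint from all others, so without it matchings have at most \<open>s - 2\<close> members, and any
nonempty nonmember can take its place. One exists, since the \<open>n \<ge> s\<close> singletons cannot all be members.\<close>

lemma remove_empty_set:
  assumes F: "F \<subseteq> Pow {1..n}" and s: "matching_number F < s" and sn: "s \<le> n"
  shows "\<exists>F' \<subseteq> Pow {1..n}. {} \<notin> F' \<and> card F' = card F \<and> matching_number F' < s"
proof (cases "{} \<in> F")
  case False
  then show ?thesis using assms by blast
next
  case True
  have fin: "finite F" using F by (rule finite_subset) simp
  have small: "card M < s" if "M \<subseteq> F" "disjoint M" for M
    using s that matching_number_less_iff[OF fin] by blast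
  have small': "card M + 1 < s" if "M \<subseteq> F - {{}}" "disjoint M" for M
  proof -
    have "finite M" using that(1) fin by (meson finite_Diff finite_subset)
    then have "card (insert {} M) = card M + 1" using that by (subst card_insert_disjoint) auto
    moreover have "card (insert {} M) < s"
      using that True by (intro small) (auto simp: disjoint_def pairwise_def)
    ultimately show ?thesis by simp
  qed
  obtain S where S: "S \<subseteq> {1..n}" "S \<noteq> {}" "S \<notin> F"
  proof (rule ccontr)
    assume *: "\<not> thesis"
    have "(\<lambda>i. {i}) ` {1..n} \<subseteq> F" using * that by blast
    moreover have "disjoint ((\<lambda>i. {i}) ` {1..n})" by (auto simp: disjoint_def)
    ultimately have "card ((\<lambda>i. {i}) ` {1..n}) < s" by (rule small)
    moreover have "card ((\<lambda>i. {i}) ` {1..n}) = n" by (subst card_image) (auto intro: inj_onI)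
    ultimately show False using sn by simp
  qed
  define F' where "F' = insert S (F - {{}})"
  have "card F' = card F" using card_Suc_Diff1[OF fin True] S fin by (simp add: F'_def)
  moreover have "matching_number F' < s"
  proof (subst matching_number_less_iff, simp add: F'_def fin, intro allI impI)
    fix M assume M: "M \<subseteq> F'" "disjoint M"
    have "finite M" using M(1) fin by (auto simp: F'_def intro: finite_subset)
    then have "card M \<le> card (M - {S}) + 1"
      using card_Suc_Diff1[of M S] by (cases "S \<in> M") auto
    moreover have "card (M - {S}) + 1 < s"
      using M by (intro small') (auto simp: F'_def intro: pairwise_subset)
    ultimately show "card M < s" by simp
  qed
  moreover have "F' \<subseteq> Pow {1..n}" "{} \<notin> F'" using F S by (auto simp: F'_def)
  ultimately show ?thesis by blast
qed

text \<open>Disjoint members of the up-closure contain disjoint members of \<open>F\<close>, which are distinct because they are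
nonempty. The ground set is shifted to \<open>{..<n}\<close> to suit arithmetic modulo \<open>n\<close>.\<close>

lemma upset_free_up_closure:
  assumes F: "F \<subseteq> Pow {1..n}" and e: "{} \<notin> F" and s: "matching_number F < s"
  shows "\<exists>G. upset_free s n G \<and> card F \<le> card G"
proof -
  define G where "G = {B. B \<subseteq> {..<n} \<and> (\<exists>A\<in>F. A \<subseteq> Suc ` B)}"
  have fin: "finite F" using F by (rule finite_subset) simp
  have img: "Suc ` {..<n} = {1..n}" by (auto simp: image_iff Suc_le_eq) (metis Suc_pred lessThan_iff less_eq_Suc_le)
  have "upset_free s n G"
    unfolding upset_free_def
  proof (intro conjI ballI allI impI notI)
    show "G \<subseteq> Pow {..<n}" by (auto simp: G_def)
  next
    fix B B' assume B: "B \<in> G" "B' \<subseteq> {..<n}" "B \<subseteq> B'"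
    then obtain A where A: "A \<in> F" "A \<subseteq> Suc ` B" by (auto simp: G_def)
    have "A \<subseteq> Suc ` B'" by (rule order_trans[OF A(2) image_mono[OF B(3)]])
    then show "B' \<in> G" using A(1) B(2) unfolding G_def by (intro CollectI conjI bexI)
  next
    assume "\<exists>A. (\<forall>i<s. A i \<in> G) \<and> disjoint_family_on A {..<s}"
    then obtain B where B: "\<forall>i<s. B i \<in> G" "disjoint_family_on B {..<s}" by blast
    then have "\<forall>i. \<exists>A. i < s \<longrightarrow> A \<in> F \<and> A \<subseteq> Suc ` B i"
      unfolding G_def by (simp only: mem_Collect_eq) metis
    then obtain A where A: "\<And>i. i < s \<Longrightarrow> A i \<in> F \<and> A i \<subseteq> Suc ` B i" by metis
    have dis: "A i \<inter> A j = {}" if "i < s" "j < s" "i \<noteq> j" for i j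
    proof -
      have "B i \<inter> B j = {}" using B(2) that by (auto simp: disjoint_family_on_def)
      then have "Suc ` B i \<inter> Suc ` B j = {}" by auto
      then show ?thesis using A[of i] A[of j] that by blast
    qed
    have "inj_on A {..<s}"
    proof (rule inj_onI, rule ccontr)
      fix i j assume "i \<in> {..<s}" "j \<in> {..<s}" "A i = A j" "i \<noteq> j"
      then have "A i = {}" using dis[of i j] by auto
      then show False using A[of i] e \<open>i \<in> {..<s}\<close> by auto
    qed
    then have "card (A ` {..<s}) = s" by (simp add: card_image)
    moreover have "A ` {..<s} \<subseteq> F" using A by auto
    moreover have "disjoint (A ` {..<s})" using dis by (auto simp: disjoint_def)
    ultimately show False
      using iffD1[OF matching_number_less_iff[OF fin] s, rule_format, of "A ` {..<s}"] by simp
  qed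
  moreover have "card F \<le> card G"
  proof (rule card_inj_on_le[of "\<lambda>A. (\<lambda>x. x - 1) ` A"])
    have undo: "Suc ` (\<lambda>x. x - 1) ` A = A" if "A \<in> F" for A
    proof -
      have "Suc (x - 1) = x" if "x \<in> A" for x using that \<open>A \<in> F\<close> F by fastforce
      then have "Suc ` (\<lambda>x. x - 1) ` A = id ` A" unfolding image_image by (intro image_cong) auto
      then show ?thesis by simp
    qed
    show "inj_on (\<lambda>A. (\<lambda>x. x - 1) ` A) F" by (rule inj_on_inverseI[of _ "\<lambda>B. Suc ` B"]) (rule undo)
    show "(\<lambda>A. (\<lambda>x. x - 1) ` A) ` F \<subseteq> G"
    proof (rule image_subsetI)
      fix A assume A: "A \<in> F"
      have "(\<lambda>x. x - 1) ` A \<subseteq> {..<n}" using A F by fastforce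
      then show "(\<lambda>x. x - 1) ` A \<in> G" using undo[OF A] A by (auto simp only: G_def mem_Collect_eq)
    qed
    show "finite G" by (rule finite_subset[of _ "Pow {..<n}"]) (auto simp: G_def)
  qed
  ultimately show ?thesis by blast
qed

section \<open>The extremal family\<close>

text \<open>Give the point 1 weight 2 and every other point weight 1. The whole ground set has weight \<open>n + 1\<close>, too
little for \<open>s\<close> disjoint sets of weight \<open>m + 1\<close>.\<close>

lemma matching_number_weighted_family:
  assumes n: "n + 1 < s * (m + 1)"
  defines "P \<equiv> {A. A \<subseteq> {1..n} \<and> m + 1 \<le> card A + of_bool (1 \<in> A)}"
  shows "matching_number P < s"
proof -
  have finP: "finite P" unfolding P_def by (rule finite_subset[of _ "Pow {1..n}"]) auto
  show ?thesis
  proof (subst matching_number_less_iff[OF finP], intro allI impI)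
    fix M assume M: "M \<subseteq> P" "disjoint M"
    have fM: "finite M" using M(1) finP finite_subset by blast
    have fA: "finite A" if "A \<in> M" for A
      using that M(1) finite_subset[of A "{1..n}"] by (auto simp: P_def)
    have "card M * (m + 1) = (\<Sum>A\<in>M. m + 1)" by simp
    also have "\<dots> \<le> (\<Sum>A\<in>M. card A + of_bool (1 \<in> A))"
      using M(1) by (intro sum_mono) (auto simp: P_def)
    also have "\<dots> = (\<Sum>A\<in>M. card A) + card {A\<in>M. 1 \<in> A}"
      using fM by (simp add: sum.distrib Int_def)
    also have "(\<Sum>A\<in>M. card A) = card (\<Union>M)"
      using card_Union_disjoint[OF M(2) fA] by simp
    also have "card (\<Union>M) \<le> card {1..n}"
      using M(1) by (intro card_mono) (auto simp: P_def)
    also have "card {A\<in>M. 1 \<in> A} \<le> 1"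
      using M(2) fM by (subst One_nat_def, subst card_le_Suc0_iff_eq) (auto simp: disjoint_def)
    finally have "card M * (m + 1) < s * (m + 1)" using n by simp
    then show "card M < s" by (simp only: mult_less_cancel2)
  qed
qed

lemma card_weighted_family:
  assumes m: "m \<ge> 1" and n: "n \<ge> 1"
  shows "card {A. A \<subseteq> {1..n} \<and> m + 1 \<le> card A + of_bool (1 \<in> A)} =
    ((n - 1) choose (m - 1)) + (\<Sum>t = m + 1..n. n choose t)"
proof -
  define S where "S = {A. A \<subseteq> {1..n} \<and> card A = m \<and> 1 \<in> A}"
  define T where "T = (\<lambda>t. {A. A \<subseteq> {1..n} \<and> card A = t})"
  have fin: "finite (T t)" for t unfolding T_def by (rule finite_subset[of _ "Pow {1..n}"]) auto
  have finS: "finite S" unfolding S_def by (rule finite_subset[of _ "Pow {1..n}"]) auto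
  have le: "card A \<le> n" if "A \<subseteq> {1..n}" for A using card_mono[OF _ that] by simp
  have eq: "{A. A \<subseteq> {1..n} \<and> m + 1 \<le> card A + of_bool (1 \<in> A)} = S \<union> (\<Union>t\<in>{m+1..n}. T t)"
  proof (intro set_eqI iffI)
    fix A assume "A \<in> {A. A \<subseteq> {1..n} \<and> m + 1 \<le> card A + of_bool (1 \<in> A)}"
    then show "A \<in> S \<union> (\<Union>t\<in>{m+1..n}. T t)"
      using le[of A] by (cases "card A \<le> m"; cases "1 \<in> A") (auto simp: S_def T_def)
  qed (auto simp: S_def T_def)
  have "card (\<Union>t\<in>{m+1..n}. T t) = (\<Sum>t = m + 1..n. card (T t))"
    using fin by (intro card_UN_disjoint) (auto simp: T_def)
  also have "\<dots> = (\<Sum>t = m + 1..n. n choose t)"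
    using n_subsets[of "{1..n}"] by (simp add: T_def)
  finally have cT: "card (\<Union>t\<in>{m+1..n}. T t) = (\<Sum>t = m + 1..n. n choose t)" .
  have "card S = card {B. B \<subseteq> {2..n} \<and> card B = m - 1}"
  proof (rule bij_betw_same_card[of "\<lambda>A. A - {1}"], rule bij_betw_byWitness[of _ "insert 1"])
    show "\<forall>A\<in>S. insert 1 (A - {1}) = A" by (auto simp: S_def)
    show "\<forall>B\<in>{B. B \<subseteq> {2..n} \<and> card B = m - 1}. insert 1 B - {1} = B" by auto
    show "(\<lambda>A. A - {1}) ` S \<subseteq> {B. B \<subseteq> {2..n} \<and> card B = m - 1}"
    proof (rule image_subsetI)
      fix A assume A: "A \<in> S"
      have "A - {1} \<subseteq> {1..n} - {1}" using A by (auto simp: S_def)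
      also have "{1..n} - {1} = {2..n}" by auto
      finally show "A - {1} \<in> {B. B \<subseteq> {2..n} \<and> card B = m - 1}" using A by (simp add: S_def)
    qed
    show "insert 1 ` {B. B \<subseteq> {2..n} \<and> card B = m - 1} \<subseteq> S"
    proof (rule image_subsetI)
      fix B assume B: "B \<in> {B. B \<subseteq> {2..n} \<and> card B = m - 1}"
      then have "finite B" "1 \<notin> B" using finite_subset[of B "{2..n}"] by auto
      then show "insert 1 B \<in> S" using B m n by (auto simp: S_def)
    qed
  qed
  also have "\<dots> = (n - 1) choose (m - 1)" using n_subsets[of "{2..n}" "m - 1"] by simp
  finally have cS: "card S = (n - 1) choose (m - 1)" .
  have "card (S \<union> (\<Union>t\<in>{m+1..n}. T t)) = card S + card (\<Union>t\<in>{m+1..n}. T t)"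
    using fin finS by (intro card_Un_disjoint) (auto simp: S_def T_def)
  then show ?thesis unfolding eq cT cS .
qed

theorem theorem1:
  fixes m s n :: nat
  assumes "m \<ge> 1" and "s \<in> {3, 4}" and "n = s * m + s - 2"
  shows "max_family_size n s = ((n - 1) choose (m - 1)) + (\<Sum>t = m + 1..n. n choose t)"
proof -
  let ?b = "((n - 1) choose (m - 1)) + (\<Sum>t = m + 1..n. n choose t)"
  let ?S = "{card F | F. F \<subseteq> Pow {1..n} \<and> matching_number F < s}"
  have sn: "s \<le> n" and n1: "n \<ge> 1" and lt: "n + 1 < s * (m + 1)" using assms by auto
  have "?S \<subseteq> card ` Pow (Pow {1..n})" by auto
  then have fin: "finite ?S" by (rule finite_subset) simp
  have mem: "?b \<in> ?S"
    using card_weighted_family[OF assms(1) n1] matching_number_weighted_family[OF lt]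
    by (intro CollectI exI[of _ "{A. A \<subseteq> {1..n} \<and> m + 1 \<le> card A + of_bool (1 \<in> A)}"]) auto
  have "x \<le> ?b" if "x \<in> ?S" for x
  proof -
    obtain F where F: "F \<subseteq> Pow {1..n}" "matching_number F < s" "x = card F" using \<open>x \<in> ?S\<close> by blast
    obtain F' where F': "F' \<subseteq> Pow {1..n}" "{} \<notin> F'" "card F' = card F" "matching_number F' < s"
      using remove_empty_set[OF F(1,2) sn] by blast
    obtain G where G: "upset_free s n G" "card F' \<le> card G"
      using upset_free_up_closure[OF F'(1,2,4)] by blast
    have "real (card G) \<le> ((n - 1) choose (m - 1)) + (\<Sum>t = m + 1..n. real (n choose t))"
      using assms card_upset_free_three[of n G m] card_upset_free_four[of n G m] G(1) by auto
    then have "real (card G) \<le> real ?b" by simp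
    then have "card G \<le> ?b" by (simp only: of_nat_le_iff)
    then show ?thesis using F(3) F'(3) G(2) by simp
  qed
  then show ?thesis
    unfolding max_family_size_def using fin mem by (intro Max_eqI) auto
qed

end
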